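(* Let $X\neq\{0\}$ be a Banach space, let $t_0<t_1$ be real numbers, let $0<\alpha<\beta\le 1$ and let $n\in\mathbb{N}$. Then $$H^{n,\beta}_{t_0}([t_0,t_1];X)\subsetneq RL^{n+\alpha}([t_0,t_1];X),$$ and the inclusion is continuous, i.e. there is $M>0$ with $\|f\|_{RL^{n+\alpha}([t_0,t_1];X)}\le M\|f\|_{H^{n,\beta}([t_0,t_1];X)}$ for all $f\in H^{n,\beta}_{t_0}([t_0,t_1];X)$.
   Context: $\mathbb{N}=\{0,1,2,\ldots\}$. $[\gamma]$ denotes the smallest integer greater than or equal to $\gamma$. For $\gamma>0$, $J_{t_0,t}^{\gamma}f(t)=\frac{1}{\Gamma(\gamma)}\int_{t_0}^{t}(t-s)^{\gamma-1}f(s)\,ds$ (Bochner integral), $J_{t_0,t}^0f=f$, and the Riemann–Liouville fractional derivative is $D_{t_0,t}^{\gamma}f(t)=\frac{d^{[\gamma]}}{dt^{[\gamma]}}\big[J_{t_0,t}^{[\gamma]-\gamma}f(t)\big]$ in the weak sense. $C^k([t_0,t_1];X)$ has norm $\sum_{j=0}^k\sup_t\|f^{(j)}(t)\|_X$. For $\gamma>0$, $RL^{\gamma}([t_0,t_1];X)=\{f\in C^{[\gamma]-1}([t_0,t_1];X): D_{t_0,t}^{\gamma}f\in C^0([t_0,t_1];X)\}$ (the weak derivative exists and has a continuous representative), with norm $\|f\|_{RL^{\gamma}}=\|f\|_{C^{[\gamma]-1}}+\|D_{t_0,t}^{\gamma}f\|_{C^0}$. For $n\in\mathbb{N}$ and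 $\beta\in(0,1]$, $H^{n,\beta}([t_0,t_1];X)$ is the space of $n$-times continuously differentiable $f:[t_0,t_1]\to X$ such that $\|f^{(n)}(t)-f^{(n)}(s)\|_X\le M|t-s|^{\beta}$ for all $t,s$ and some $M>0$, with norm $\|f\|_{C^n}+\sup_{t\neq s}\frac{\|f^{(n)}(t)-f^{(n)}(s)\|_X}{|t-s|^{\beta}}$, and $H^{n,\beta}_{t_0}([t_0,t_1];X)=\{f\in H^{n,\beta}([t_0,t_1];X): f^{(i)}(t_0)=0,\ i=0,\ldots,n\}$. *)

theory Defs
  imports "HOL-Analysis.Analysis"
begin

text \<open>
  A function \<open>[t0, t1] \<rightarrow> X\<close> is represented by a total function \<^typ>\<open>real \<Rightarrow> 'a\<close>; everything below
  depends only on the values on \<open>[t0, t1]\<close>, and membership in the function spaces does not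
  constrain the values elsewhere.
\<close>

text \<open>
  The library's \<^const>\<open>has_bochner_integral\<close> requires a separable codomain
  (\<^class>\<open>second_countable_topology\<close>). The definition is repeated here without that sort
  constraint. For measurable \<open>f\<close> the functions \<open>norm (f x - s i x)\<close> are still measurable because
  \<open>s i\<close> is simple, and the convergence forces \<open>f\<close> to be strongly measurable.
\<close>

definition has_bochner :: "'m measure \<Rightarrow> ('m \<Rightarrow> 'a::banach) \<Rightarrow> 'a \<Rightarrow> bool" where
  "has_bochner M f x \<longleftrightarrow>
     f \<in> borel_measurable M \<and>
     (\<exists>s. (\<forall>i. Bochner_Integration.simple_bochner_integrable M (s i)) \<and>
          (\<lambda>i. \<integral>\<^sup>+ t. ennreal (norm (f t - s i t)) \<partial>M) \<longlonglongrightarrow> 0 \<and>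
          (\<lambda>i. Bochner_Integration.simple_bochner_integral M (s i)) \<longlonglongrightarrow> x)"

definition bochner_integrable :: "'m measure \<Rightarrow> ('m \<Rightarrow> 'a::banach) \<Rightarrow> bool" where
  "bochner_integrable M f \<longleftrightarrow> (\<exists>x. has_bochner M f x)"

definition bochner_integral :: "'m measure \<Rightarrow> ('m \<Rightarrow> 'a::banach) \<Rightarrow> 'a" where
  "bochner_integral M f =
     (if bochner_integrable M f then THE x. has_bochner M f x else 0)"

lemma has_bochner_eq_library:
  fixes f :: "'m \<Rightarrow> 'a::{banach, second_countable_topology}"
  shows "has_bochner M f = has_bochner_integral M f"
  by (auto simp: fun_eq_iff has_bochner_def has_bochner_integral.simps)

lemma bochner_integral_eq_library:
  fixes f :: "'m \<Rightarrow> 'a::{banach, second_countable_topology}"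
  shows "bochner_integral M f = integral\<^sup>L M f"
  by (simp add: bochner_integral_def bochner_integrable_def has_bochner_eq_library
      lebesgue_integral_def)

text \<open>Derivatives at the end points of the interval are one-sided.\<close>

fun nth_deriv :: "real \<Rightarrow> real \<Rightarrow> nat \<Rightarrow> (real \<Rightarrow> 'a::banach) \<Rightarrow> real \<Rightarrow> 'a" where
  "nth_deriv t0 t1 0 f = f"
| "nth_deriv t0 t1 (Suc j) f =
     (\<lambda>t. vector_derivative (nth_deriv t0 t1 j f) (at t within {t0..t1}))"

definition C_space :: "nat \<Rightarrow> real \<Rightarrow> real \<Rightarrow> (real \<Rightarrow> 'a::banach) set" where
  "C_space k t0 t1 =
     {f. (\<forall>j<k. nth_deriv t0 t1 j f differentiable_on {t0..t1}) \<and>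
         continuous_on {t0..t1} (nth_deriv t0 t1 k f)}"

definition C_norm :: "nat \<Rightarrow> real \<Rightarrow> real \<Rightarrow> (real \<Rightarrow> 'a::banach) \<Rightarrow> real" where
  "C_norm k t0 t1 f = (\<Sum>j=0..k. SUP t\<in>{t0..t1}. norm (nth_deriv t0 t1 j f t))"

definition H_space :: "nat \<Rightarrow> real \<Rightarrow> real \<Rightarrow> real \<Rightarrow> (real \<Rightarrow> 'a::banach) set" where
  "H_space n \<beta> t0 t1 =
     {f \<in> C_space n t0 t1.
        \<exists>M>0. \<forall>t\<in>{t0..t1}. \<forall>s\<in>{t0..t1}.
          norm (nth_deriv t0 t1 n f t - nth_deriv t0 t1 n f s) \<le> M * \<bar>t - s\<bar> powr \<beta>}"

definition H_norm :: "nat \<Rightarrow> real \<Rightarrow> real \<Rightarrow> real \<Rightarrow> (real \<Rightarrow> 'a::banach) \<Rightarrow> real" where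
  "H_norm n \<beta> t0 t1 f =
     C_norm n t0 t1 f +
     (SUP (t, s)\<in>{(t, s). t \<in> {t0..t1} \<and> s \<in> {t0..t1} \<and> t \<noteq> s}.
        norm (nth_deriv t0 t1 n f t - nth_deriv t0 t1 n f s) / \<bar>t - s\<bar> powr \<beta>)"

definition H0_space :: "nat \<Rightarrow> real \<Rightarrow> real \<Rightarrow> real \<Rightarrow> (real \<Rightarrow> 'a::banach) set" where
  "H0_space n \<beta> t0 t1 = {f \<in> H_space n \<beta> t0 t1. \<forall>i\<le>n. nth_deriv t0 t1 i f t0 = 0}"

text \<open>For \<open>\<gamma> < 1\<close> the kernel is singular at \<open>s = t\<close>, where \<open>0 powr (\<gamma> - 1) = 0\<close> by convention;
  this affects the integrand on a null set only.\<close>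

definition RL_integral :: "real \<Rightarrow> real \<Rightarrow> (real \<Rightarrow> 'a::banach) \<Rightarrow> real \<Rightarrow> 'a" where
  "RL_integral \<gamma> t0 f t =
     (if \<gamma> = 0 then f t
      else (1 / Gamma \<gamma>) *\<^sub>R
             bochner_integral (lebesgue_on {t0..t}) (\<lambda>s. (t - s) powr (\<gamma> - 1) *\<^sub>R f s))"

definition test_functions :: "real \<Rightarrow> real \<Rightarrow> (real \<Rightarrow> real) set" where
  "test_functions t0 t1 =
     {\<phi>. (\<forall>j. (deriv ^^ j) \<phi> differentiable_on UNIV) \<and>
         closure {t. \<phi> t \<noteq> 0} \<subseteq> {t0<..<t1}}"

definition locally_integrable :: "real \<Rightarrow> real \<Rightarrow> (real \<Rightarrow> 'a::banach) \<Rightarrow> bool" where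
  "locally_integrable t0 t1 g \<longleftrightarrow>
     (\<forall>a b. t0 < a \<and> a \<le> b \<and> b < t1 \<longrightarrow> bochner_integrable (lebesgue_on {a..b}) g)"

definition has_weak_deriv ::
  "real \<Rightarrow> real \<Rightarrow> nat \<Rightarrow> (real \<Rightarrow> 'a::banach) \<Rightarrow> (real \<Rightarrow> 'a) \<Rightarrow> bool" where
  "has_weak_deriv t0 t1 k g v \<longleftrightarrow>
     locally_integrable t0 t1 g \<and> locally_integrable t0 t1 v \<and>
     (\<forall>\<phi>\<in>test_functions t0 t1.
        bochner_integral (lebesgue_on {t0..t1}) (\<lambda>t. (deriv ^^ k) \<phi> t *\<^sub>R g t) =
        (-1) ^ k *\<^sub>R bochner_integral (lebesgue_on {t0..t1}) (\<lambda>t. \<phi> t *\<^sub>R v t))"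

definition has_RL_deriv ::
  "real \<Rightarrow> real \<Rightarrow> real \<Rightarrow> (real \<Rightarrow> 'a::banach) \<Rightarrow> (real \<Rightarrow> 'a) \<Rightarrow> bool" where
  "has_RL_deriv \<gamma> t0 t1 f v \<longleftrightarrow>
     has_weak_deriv t0 t1 (nat \<lceil>\<gamma>\<rceil>) (RL_integral (of_int \<lceil>\<gamma>\<rceil> - \<gamma>) t0 f) v"

text \<open>
  The weak derivative is determined up to null sets, so its continuous representative, if there
  is one, is determined on \<open>[t0, t1]\<close>; the choice below only concerns values off the interval.
\<close>

definition RL_deriv :: "real \<Rightarrow> real \<Rightarrow> real \<Rightarrow> (real \<Rightarrow> 'a::banach) \<Rightarrow> real \<Rightarrow> 'a" where
  "RL_deriv \<gamma> t0 t1 f = (SOME v. v \<in> C_space 0 t0 t1 \<and> has_RL_deriv \<gamma> t0 t1 f v)"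

definition RL_space :: "real \<Rightarrow> real \<Rightarrow> real \<Rightarrow> (real \<Rightarrow> 'a::banach) set" where
  "RL_space \<gamma> t0 t1 =
     {f \<in> C_space (nat \<lceil>\<gamma>\<rceil> - 1) t0 t1. \<exists>v\<in>C_space 0 t0 t1. has_RL_deriv \<gamma> t0 t1 f v}"

definition RL_norm :: "real \<Rightarrow> real \<Rightarrow> real \<Rightarrow> (real \<Rightarrow> 'a::banach) \<Rightarrow> real" where
  "RL_norm \<gamma> t0 t1 f =
     C_norm (nat \<lceil>\<gamma>\<rceil> - 1) t0 t1 f + C_norm 0 t0 t1 (RL_deriv \<gamma> t0 t1 f)"

end

theory Submission
  imports Defs
begin

text \<open>
  For \<open>f\<close> with \<open>f\<^bsup>(i)\<^esup>(t0) = 0\<close>, \<open>i \<le> n\<close>, the fractional integral \<open>J\<^bsup>1 - \<alpha>\<^esup>\<close> commutes with the first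
  \<open>n\<close> derivatives, so everything reduces to \<open>g = f\<^bsup>(n)\<^esup>\<close>, which is \<open>\<beta>\<close>-Hoelder with \<open>g(t0) = 0\<close>.
  Replace the kernel \<open>u powr (- \<alpha>)\<close> by \<open>(u + \<epsilon>) powr (- \<alpha>)\<close>. The regularised integral of \<open>g\<close> is
  continuously differentiable with derivative
  \<open>(L + \<epsilon>) powr (- \<alpha>) g(t) + \<alpha> \<integral> (u + \<epsilon>) powr (- \<alpha> - 1) (g(t) - g(t - u)) du\<close>
  (\<open>0 \<le> u \<le> L = t1 - t0\<close>, \<open>g = 0\<close> to the left of \<open>t0\<close>).
  As \<open>\<epsilon>\<close> decreases, the differences of these derivatives are dominated by the differences of
  the same expressions with \<open>u powr \<beta>\<close> in place of the increments of \<open>g\<close>; the latter are monotone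
  in \<open>\<epsilon>\<close> and bounded because \<open>\<alpha> < \<beta>\<close>. Hence the derivatives converge uniformly, \<open>J\<^bsup>1 - \<alpha>\<^esup> g\<close> is
  \<open>C\<^sup>1\<close>, and its derivative is bounded by a multiple of the Hoelder seminorm. Continuous
  weak derivatives are unique, which turns this into the norm bound.
  The inclusion is strict because of \<open>(t - t0) powr (n + \<alpha>) x\<close>: its image under \<open>J\<^bsup>1 - \<alpha>\<^esup>\<close> is a
  multiple of \<open>(t - t0) ^ (n + 1) x\<close>, but its \<open>n\<close>-th derivative is only \<open>\<alpha>\<close>-Hoelder at \<open>t0\<close>.
\<close>

section \<open>Bochner integral without separability\<close>

text \<open>A simple function has finitely many values, so it is measurable into a counting space,
  and for each fixed value \<open>y\<close> the map \<open>norm (f x - y)\<close> is a continuous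
  function of \<open>f x\<close>. This avoids measurability of subtraction on pairs, which can fail
  in a nonseparable space.\<close>

lemma borel_measurable_norm_diff_simple:
  fixes f s :: "'m \<Rightarrow> 'a::real_normed_vector"
  assumes f: "f \<in> borel_measurable M" and s: "simple_function M s"
  shows "(\<lambda>x. norm (f x - s x)) \<in> borel_measurable M"
proof -
  have sm: "s \<in> measurable M (count_space (s ` space M))"
    using s by (subst measurable_count_space_eq2) (auto simp: simple_function_def)
  show ?thesis
  proof (rule measurable_compose_countable'[where f="\<lambda>y x. norm (f x - y)", OF _ sm])
    show "countable (s ` space M)"
      using s by (simp add: simple_function_def countable_finite)
    show "(\<lambda>x. norm (f x - i)) \<in> borel_measurable M" for i
      by (rule measurable_compose[OF f borel_measurable_continuous_onI])
        (intro continuous_intros)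
  qed
qed

lemma has_bochner_approx:
  assumes "has_bochner M f x" "e > 0"
  obtains s where "Bochner_Integration.simple_bochner_integrable M s"
    "(\<lambda>t. norm (f t - s t)) \<in> borel_measurable M"
    "(\<integral>\<^sup>+ t. ennreal (norm (f t - s t)) \<partial>M) < ennreal e"
    "norm (Bochner_Integration.simple_bochner_integral M s - x) < e"
proof -
  from assms(1) obtain s where f: "f \<in> borel_measurable M"
    and s: "\<And>i. Bochner_Integration.simple_bochner_integrable M (s i)"
    and l1: "(\<lambda>i. \<integral>\<^sup>+ t. ennreal (norm (f t - s i t)) \<partial>M) \<longlonglongrightarrow> 0"
    and l2: "(\<lambda>i. Bochner_Integration.simple_bochner_integral M (s i)) \<longlonglongrightarrow> x"
    unfolding has_bochner_def by blast
  have "\<forall>\<^sub>F i in sequentially. (\<integral>\<^sup>+ t. ennreal (norm (f t - s i t)) \<partial>M) < ennreal e"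
    using l1 \<open>e > 0\<close> by (intro order_tendstoD) auto
  moreover have "\<forall>\<^sub>F i in sequentially. norm (Bochner_Integration.simple_bochner_integral M (s i) - x) < e"
    using tendstoD[OF l2 \<open>e > 0\<close>] by (simp add: dist_norm)
  ultimately have "\<forall>\<^sub>F i in sequentially. (\<integral>\<^sup>+ t. ennreal (norm (f t - s i t)) \<partial>M) < ennreal e
      \<and> norm (Bochner_Integration.simple_bochner_integral M (s i) - x) < e"
    by (rule eventually_conj)
  then obtain i where "(\<integral>\<^sup>+ t. ennreal (norm (f t - s i t)) \<partial>M) < ennreal e"
      "norm (Bochner_Integration.simple_bochner_integral M (s i) - x) < e"
    unfolding eventually_sequentially by auto
  moreover have "(\<lambda>t. norm (f t - s i t)) \<in> borel_measurable M"
    using s[of i] by (intro borel_measurable_norm_diff_simple f) (auto elim: Bochner_Integration.simple_bochner_integrable.cases)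
  ultimately show thesis using s that by blast
qed

text \<open>Both functions are replaced by simple ones that are close in the mean and in the
  integral; for these the norm inequality is elementary. In a nonseparable space a difference of
  measurable functions may fail to be measurable, so the estimate runs through a measurable majorant
  \<open>e\<close> of \<open>norm (f z - g z)\<close>. It yields uniqueness of the integral
  (\<open>e\<close> = 0) and later the Cauchy estimates.\<close>

lemma has_bochner_diff_bound:
  assumes f: "has_bochner M f x" and g: "has_bochner M g y"
    and e [measurable]: "e \<in> borel_measurable M"
    and le: "\<And>z. z \<in> space M \<Longrightarrow> norm (f z - g z) \<le> e z"
  shows "ennreal (norm (x - y)) \<le> (\<integral>\<^sup>+ z. ennreal (e z) \<partial>M)"
proof (rule ennreal_le_epsilon)
  fix d :: real assume "d > 0"
  then have d: "d / 4 > 0" by simp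
  obtain s where s: "Bochner_Integration.simple_bochner_integrable M s"
      and ms [measurable]: "(\<lambda>t. norm (f t - s t)) \<in> borel_measurable M"
      and s1: "(\<integral>\<^sup>+ t. ennreal (norm (f t - s t)) \<partial>M) < ennreal (d / 4)"
      and s2: "norm (Bochner_Integration.simple_bochner_integral M s - x) < d / 4"
    using has_bochner_approx[OF f d] by blast
  obtain r where r: "Bochner_Integration.simple_bochner_integrable M r"
      and mr [measurable]: "(\<lambda>t. norm (g t - r t)) \<in> borel_measurable M"
      and r1: "(\<integral>\<^sup>+ t. ennreal (norm (g t - r t)) \<partial>M) < ennreal (d / 4)"
      and r2: "norm (Bochner_Integration.simple_bochner_integral M r - y) < d / 4"
    using has_bochner_approx[OF g d] by blast
  let ?s = "Bochner_Integration.simple_bochner_integral M s" and ?r = "Bochner_Integration.simple_bochner_integral M r"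
  have "ennreal (norm (?s - ?r)) = norm (Bochner_Integration.simple_bochner_integral M (\<lambda>x. s x - r x))"
    using s r by (subst simple_bochner_integral_diff) auto
  also have "\<dots> \<le> Bochner_Integration.simple_bochner_integral M (\<lambda>x. norm (s x - r x))"
    using Bochner_Integration.simple_bochner_integrable_compose2[of "(-)" M s r] s r
    by (auto intro!: simple_bochner_integral_norm_bound)
  also have "\<dots> = (\<integral>\<^sup>+x. norm (s x - r x) \<partial>M)"
    using Bochner_Integration.simple_bochner_integrable_compose2[of "\<lambda>x y. norm (x - y)" M s r] s r
    by (auto intro!: simple_bochner_integral_eq_nn_integral)
  also have "\<dots> \<le> (\<integral>\<^sup>+x. (ennreal (norm (f x - s x)) + ennreal (norm (g x - r x))) + ennreal (e x) \<partial>M)"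
  proof (rule nn_integral_mono)
    fix x assume "x \<in> space M"
    have "norm (s x - r x) \<le> norm (f x - s x) + norm (g x - r x) + norm (f x - g x)"
      by norm
    also have "\<dots> \<le> norm (f x - s x) + norm (g x - r x) + e x"
      using le[OF \<open>x \<in> space M\<close>] by simp
    finally have *: "norm (s x - r x) \<le> norm (f x - s x) + norm (g x - r x) + e x" .
    have "0 \<le> e x" using le[OF \<open>x \<in> space M\<close>] norm_ge_zero order_trans by blast
    then show "ennreal (norm (s x - r x))
        \<le> (ennreal (norm (f x - s x)) + ennreal (norm (g x - r x))) + ennreal (e x)"
      using * by (simp flip: ennreal_plus)
  qed
  also have "\<dots> = (\<integral>\<^sup>+x. ennreal (norm (f x - s x)) \<partial>M) + (\<integral>\<^sup>+x. ennreal (norm (g x - r x)) \<partial>M)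
      + (\<integral>\<^sup>+x. ennreal (e x) \<partial>M)"
    by (subst nn_integral_add, simp, simp, subst nn_integral_add) simp_all
  also have "\<dots> \<le> ennreal (d / 4) + ennreal (d / 4) + (\<integral>\<^sup>+x. ennreal (e x) \<partial>M)"
    using s1 r1 by (intro add_mono order_refl) auto
  finally have b: "ennreal (norm (?s - ?r)) \<le> ennreal (d / 2) + (\<integral>\<^sup>+x. ennreal (e x) \<partial>M)"
    using d by (simp flip: ennreal_plus)
  have "norm (x - y) \<le> norm (?s - ?r) + (norm (?s - x) + norm (?r - y))"
    by norm
  also have "\<dots> \<le> norm (?s - ?r) + d / 2" using s2 r2 by simp
  finally have "ennreal (norm (x - y)) \<le> ennreal (norm (?s - ?r)) + ennreal (d / 2)"
    using d by (simp flip: ennreal_plus)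
  also have "\<dots> \<le> (ennreal (d / 2) + (\<integral>\<^sup>+x. ennreal (e x) \<partial>M)) + ennreal (d / 2)"
    using b by (intro add_right_mono)
  also have "\<dots> = (\<integral>\<^sup>+x. ennreal (e x) \<partial>M) + (ennreal (d / 2) + ennreal (d / 2))"
    by (simp add: ac_simps)
  also have "ennreal (d / 2) + ennreal (d / 2) = ennreal d"
    using d by (simp flip: ennreal_plus)
  finally show "ennreal (norm (x - y)) \<le> (\<integral>\<^sup>+ z. ennreal (e z) \<partial>M) + ennreal d" .
qed

lemma has_bochner_unique:
  assumes "has_bochner M f x" "has_bochner M f y"
  shows "x = y"
  using has_bochner_diff_bound[OF assms, of "\<lambda>_. 0"] by simp

lemma bochner_integral_eq:
  assumes "has_bochner M f x"
  shows "bochner_integral M f = x"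
proof -
  have "(THE y. has_bochner M f y) = x"
    using assms has_bochner_unique by (intro the_equality)
  then show ?thesis using assms by (auto simp: bochner_integral_def bochner_integrable_def)
qed

lemma has_bochner_cong:
  assumes "\<And>t. t \<in> space M \<Longrightarrow> f t = g t"
  shows "has_bochner M f x \<longleftrightarrow> has_bochner M g x"
  unfolding has_bochner_def using assms
  by (simp cong: measurable_cong_simp nn_integral_cong_simp)

text \<open>Diagonal choice: a simple function within 1/(i+1) of \<open>h i\<close>, both in the
  mean and in the integral, also approximates \<open>f\<close>, with the extra error controlled by
  the integral of \<open>e i\<close>.\<close>

lemma has_bochner_limit:
  assumes f [measurable]: "f \<in> borel_measurable M"
    and h: "\<And>i. has_bochner M (h i) (y i)"
    and e [measurable]: "\<And>i. e i \<in> borel_measurable M"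
    and le: "\<And>i z. z \<in> space M \<Longrightarrow> norm (f z - h i z) \<le> e i z"
    and lim: "(\<lambda>i. \<integral>\<^sup>+ z. ennreal (e i z) \<partial>M) \<longlonglongrightarrow> 0"
    and y: "y \<longlonglongrightarrow> x"
  shows "has_bochner M f x"
proof -
  have "\<exists>s. Bochner_Integration.simple_bochner_integrable M s \<and>
      (\<lambda>t. norm (h i t - s t)) \<in> borel_measurable M \<and>
      (\<integral>\<^sup>+ t. ennreal (norm (h i t - s t)) \<partial>M) < ennreal (inverse (Suc i)) \<and>
      norm (Bochner_Integration.simple_bochner_integral M s - y i) < inverse (Suc i)" for i
  proof -
    have "0 < inverse (real (Suc i))" by simp
    from has_bochner_approx[OF h[of i] this] show ?thesis by blast
  qed
  then have "\<exists>s. \<forall>i. Bochner_Integration.simple_bochner_integrable M (s i) \<and>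
      (\<lambda>t. norm (h i t - s i t)) \<in> borel_measurable M \<and>
      (\<integral>\<^sup>+ t. ennreal (norm (h i t - s i t)) \<partial>M) < ennreal (inverse (Suc i)) \<and>
      norm (Bochner_Integration.simple_bochner_integral M (s i) - y i) < inverse (Suc i)"
    by (intro choice allI)
  then obtain s where s: "\<And>i. Bochner_Integration.simple_bochner_integrable M (s i)"
    and ms [measurable]: "\<And>i. (\<lambda>t. norm (h i t - s i t)) \<in> borel_measurable M"
    and s1: "\<And>i. (\<integral>\<^sup>+ t. ennreal (norm (h i t - s i t)) \<partial>M) < ennreal (inverse (Suc i))"
    and s2: "\<And>i. norm (Bochner_Integration.simple_bochner_integral M (s i) - y i) < inverse (Suc i)"
    by blast
  have inv0: "(\<lambda>i. inverse (real (Suc i))) \<longlonglongrightarrow> 0"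
    by (rule LIMSEQ_inverse_real_of_nat)
  have "(\<lambda>i. Bochner_Integration.simple_bochner_integral M (s i) - y i) \<longlonglongrightarrow> 0"
    using s2 by (intro Lim_null_comparison[OF _ inv0] always_eventually allI less_imp_le)
  from tendsto_add[OF this y] have A: "(\<lambda>i. Bochner_Integration.simple_bochner_integral M (s i)) \<longlonglongrightarrow> x"
    by simp
  have "(\<lambda>i. ennreal (inverse (real (Suc i)))) \<longlonglongrightarrow> ennreal 0"
    using inv0 by (rule tendsto_ennrealI)
  from tendsto_add[OF this lim] have up:
    "(\<lambda>i. ennreal (inverse (real (Suc i))) + (\<integral>\<^sup>+ z. ennreal (e i z) \<partial>M)) \<longlonglongrightarrow> 0"
    by simp
  have "(\<integral>\<^sup>+ t. ennreal (norm (f t - s i t)) \<partial>M) \<le>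
      ennreal (inverse (real (Suc i))) + (\<integral>\<^sup>+ z. ennreal (e i z) \<partial>M)" for i
  proof -
    have "(\<integral>\<^sup>+ t. ennreal (norm (f t - s i t)) \<partial>M) \<le>
        (\<integral>\<^sup>+ t. ennreal (norm (h i t - s i t)) + ennreal (e i t) \<partial>M)"
    proof (rule nn_integral_mono)
      fix t assume t: "t \<in> space M"
      have "0 \<le> e i t" using le[OF t] norm_ge_zero order_trans by blast
      moreover have "norm (f t - s i t) \<le> norm (h i t - s i t) + norm (f t - h i t)"
        by norm
      ultimately show "ennreal (norm (f t - s i t)) \<le> ennreal (norm (h i t - s i t)) + ennreal (e i t)"
        using le[OF t, of i] by (simp flip: ennreal_plus)
    qed
    also have "\<dots> = (\<integral>\<^sup>+ t. ennreal (norm (h i t - s i t)) \<partial>M) + (\<integral>\<^sup>+ t. ennreal (e i t) \<partial>M)"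
      by (rule nn_integral_add) auto
    also have "\<dots> \<le> ennreal (inverse (real (Suc i))) + (\<integral>\<^sup>+ z. ennreal (e i z) \<partial>M)"
      using s1[of i] by (intro add_right_mono) simp
    finally show ?thesis .
  qed
  then have B: "(\<lambda>i. \<integral>\<^sup>+ t. ennreal (norm (f t - s i t)) \<partial>M) \<longlonglongrightarrow> 0"
    by (intro tendsto_sandwich[OF _ _ tendsto_const up] always_eventually allI) auto
  show ?thesis
    unfolding has_bochner_def using f s A B by blast
qed

section \<open>Bochner integrals of continuous functions as gauge integrals\<close>

text \<open>A simple function is the finite sum of its values times the indicators of its level
  sets, and the gauge integral of an indicator is the measure of the set.\<close>

lemma has_integral_simple_bochner_integral:
  fixes s :: "real \<Rightarrow> 'a::banach"
  assumes S: "S \<in> lmeasurable" and s: "simple_function (lebesgue_on S) s"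
  shows "(s has_integral Bochner_Integration.simple_bochner_integral (lebesgue_on S) s) S"
proof -
  have fin: "finite (s ` S)" using s by (simp add: simple_function_def)
  have "((\<lambda>x. indicat_real {x\<in>S. s x = y} x *\<^sub>R y) has_integral
      measure (lebesgue_on S) {x\<in>S. s x = y} *\<^sub>R y) S" if "y \<in> s ` S" for y
  proof -
    have "s -` {y} \<inter> S \<in> sets (lebesgue_on S)"
      using s that by (auto simp: simple_function_def)
    moreover have "s -` {y} \<inter> S = {x\<in>S. s x = y}" by auto
    ultimately have "{x\<in>S. s x = y} \<in> sets lebesgue"
      using S by (auto simp: sets_restrict_space_iff fmeasurableD)
    then have "{x\<in>S. s x = y} \<in> lmeasurable"
      using S by (intro fmeasurableI2[OF S]) auto
    then have "(indicat_real {x\<in>S. s x = y} has_integral measure lebesgue {x\<in>S. s x = y}) UNIV"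
      by (simp add: lmeasurable_iff_has_integral)
    also have "indicat_real {x\<in>S. s x = y} =
        (\<lambda>x. if x \<in> S then indicat_real {x\<in>S. s x = y} x else 0)"
      by (auto simp: indicator_def)
    finally have "(indicat_real {x\<in>S. s x = y} has_integral measure lebesgue {x\<in>S. s x = y}) S"
      by (simp only: has_integral_restrict_UNIV)
    moreover have "measure (lebesgue_on S) {x\<in>S. s x = y} = measure lebesgue {x\<in>S. s x = y}"
      using S by (intro measure_restrict_space) (auto simp: fmeasurableD)
    ultimately show ?thesis by (metis has_integral_scaleR_left)
  qed
  then have "((\<lambda>x. \<Sum>y\<in>s ` S. indicat_real {x\<in>S. s x = y} x *\<^sub>R y) has_integral
      (\<Sum>y\<in>s ` S. measure (lebesgue_on S) {x\<in>S. s x = y} *\<^sub>R y)) S"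
    using fin by (intro has_integral_sum)
  then show ?thesis
    unfolding Bochner_Integration.simple_bochner_integral_def space_lebesgue_on
  proof (rule has_integral_eq[rotated])
    fix x assume that: "x \<in> S"
    have "(\<Sum>y\<in>s ` S. indicat_real {x\<in>S. s x = y} x *\<^sub>R y) = (\<Sum>y\<in>s ` S. if y = s x then y else 0)"
      using that by (intro sum.cong) auto
    also have "\<dots> = s x" using fin that by simp
    finally show "(\<Sum>y\<in>s ` S. indicat_real {x\<in>S. s x = y} x *\<^sub>R y) = s x" .
  qed
qed

text \<open>Step functions sampling \<open>f\<close> on a grid converge to it uniformly on the
  interval. As the interval has finite measure, this gives convergence in the mean and convergence
  of the integrals to the gauge integral.\<close>

lemma has_bochner_continuous:
  fixes f :: "real \<Rightarrow> 'a::banach"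
  assumes ab: "a \<le> b" and f: "continuous_on {a..b} f"
  shows "has_bochner (lebesgue_on {a..b}) f (integral {a..b} f)"
proof -
  let ?M = "lebesgue_on {a..b}"
  \<comment> \<open>The value of \<open>f\<close> at the nearest point to the left of
    \<open>x\<close> on the grid of width 1/(i+1) starting at \<open>a\<close>; that point stays in
    the interval and is less than 1/(i+1) away.\<close>
  define s where "s i x = f (a + of_int \<lfloor>(x - a) * real (Suc i)\<rfloor> / real (Suc i))" for i x
  have em: "emeasure ?M A \<noteq> \<infinity>" for A
  proof -
    have "emeasure ?M A \<le> emeasure ?M {a..b}"
      by (metis emeasure_space space_lebesgue_on)
    also have "\<dots> < \<infinity>" by (simp add: emeasure_restrict_space emeasure_lborel_Icc_eq)
    finally show ?thesis by simp
  qed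
  have simple: "simple_function ?M (s i)" for i
  proof -
    have "simple_function ?M (\<lambda>x. \<lfloor>(x - a) * real (Suc i)\<rfloor>)"
      unfolding simple_function_eq_measurable
    proof
      have "(\<lambda>x. \<lfloor>(x - a) * real (Suc i)\<rfloor>) ` {a..b} \<subseteq> {0..\<lfloor>(b - a) * real (Suc i)\<rfloor>}"
        by (auto intro!: floor_mono mult_right_mono)
      then show "finite ((\<lambda>x. \<lfloor>(x - a) * real (Suc i)\<rfloor>) ` space ?M)"
        by (metis finite_atLeastAtMost_int finite_subset space_lebesgue_on)
      have "(\<lambda>x. (x - a) * real (Suc i)) \<in> borel_measurable ?M"
        by (intro continuous_imp_measurable_on_sets_lebesgue continuous_intros) auto
      then show "(\<lambda>x. \<lfloor>(x - a) * real (Suc i)\<rfloor>) \<in> measurable ?M (count_space UNIV)"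
        by measurable
    qed
    then show ?thesis unfolding s_def
      by (rule simple_function_compose1)
  qed
  have sbi: "Bochner_Integration.simple_bochner_integrable ?M (s i)" for i
    using simple[of i] em by (rule Bochner_Integration.simple_bochner_integrable.intros)
  have fi: "f integrable_on {a..b}" using f by (rule integrable_continuous_real)
  have si: "(s i has_integral Bochner_Integration.simple_bochner_integral ?M (s i)) {a..b}" for i
    by (intro has_integral_simple_bochner_integral simple) auto
  have unif: "\<forall>\<^sub>F i in sequentially. \<forall>x\<in>{a..b}. norm (f x - s i x) \<le> e" if "e > 0" for e
  proof -
    have "uniformly_continuous_on {a..b} f"
      using f by (intro compact_uniformly_continuous) auto
    then obtain d where d: "d > 0" "\<And>x y. \<lbrakk>x \<in> {a..b}; y \<in> {a..b}; dist y x < d\<rbrakk> \<Longrightarrow> dist (f y) (f x) < e"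
      using \<open>e > 0\<close> unfolding uniformly_continuous_on_def by metis
    have "\<forall>\<^sub>F i in sequentially. inverse (real (Suc i)) < d"
      using d(1) by (intro order_tendstoD(2)[OF LIMSEQ_inverse_real_of_nat])
    then show ?thesis
    proof eventually_elim
      case (elim i)
      show ?case
      proof
        fix x assume x: "x \<in> {a..b}"
        define N where "N = real (Suc i)"
        define y where "y = a + of_int \<lfloor>(x - a) * N\<rfloor> / N"
        have N: "N > 0" by (simp add: N_def)
        have "of_int \<lfloor>(x - a) * N\<rfloor> \<le> (x - a) * N" by linarith
        then have y1: "y \<le> x" using N by (simp add: y_def field_simps)
        have "0 \<le> real_of_int \<lfloor>(x - a) * N\<rfloor>" using x N by simp
        then have y0: "a \<le> y" using N unfolding y_def by simp
        have "(x - a) * N < of_int \<lfloor>(x - a) * N\<rfloor> + 1" by linarith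
        then have "((x - a) * N - of_int \<lfloor>(x - a) * N\<rfloor>) / N < 1 / N"
          using N by (intro divide_strict_right_mono) linarith+
        moreover have "x - y = ((x - a) * N - of_int \<lfloor>(x - a) * N\<rfloor>) / N"
          using N by (simp add: y_def field_simps)
        ultimately have "x - y < inverse N" by (simp add: inverse_eq_divide)
        then have "dist y x < d" using elim y1 by (simp add: dist_real_def N_def)
        then have "dist (f y) (f x) < e" using d(2) x y0 y1 by auto
        then show "norm (f x - s i x) \<le> e"
          by (simp add: s_def y_def N_def dist_norm norm_minus_commute)
      qed
    qed
  qed
  have fm: "f \<in> borel_measurable ?M"
    using f by (rule continuous_imp_measurable_on_sets_lebesgue) auto
  have "(\<lambda>i. \<integral>\<^sup>+ t. ennreal (norm (f t - s i t)) \<partial>?M) \<longlonglongrightarrow> 0"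
  proof (rule tendsto_zero_ennreal)
    fix r :: real assume r: "0 < r"
    \<comment> \<open>The added 1 keeps the denominator positive when \<open>a = b\<close> and
      leaves room for the strict inequality \<open>e * (b - a) < r\<close>.\<close>
    define e where "e = r / (2 * (b - a + 1))"
    have e: "e > 0" using r ab by (simp add: e_def)
    have "e * (2 * (b - a + 1)) = r" using ab by (simp add: e_def)
    moreover have "0 \<le> e * (b - a)" using e ab by simp
    moreover have "e * (2 * (b - a + 1)) = 2 * (e * (b - a)) + 2 * e" by algebra
    ultimately have er: "e * (b - a) < r" using e by linarith
    show "\<forall>\<^sub>F i in sequentially. (\<integral>\<^sup>+ t. ennreal (norm (f t - s i t)) \<partial>?M) < ennreal r"
      using unif[OF e]
    proof eventually_elim
      case (elim i)
      have "(\<integral>\<^sup>+ t. ennreal (norm (f t - s i t)) \<partial>?M) \<le> (\<integral>\<^sup>+ t. ennreal e \<partial>?M)"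
        using elim by (intro nn_integral_mono ennreal_leI) simp
      also have "\<dots> = ennreal (e * (b - a))"
        using ab e by (simp add: emeasure_restrict_space ennreal_mult)
      also have "\<dots> < ennreal r"
        using er r by (intro ennreal_lessI)
      finally show ?case .
    qed
  qed
  moreover have "(\<lambda>i. Bochner_Integration.simple_bochner_integral ?M (s i)) \<longlonglongrightarrow> integral {a..b} f"
  proof (rule tendstoI)
    fix r :: real assume r: "0 < r"
    define e where "e = r / (2 * (b - a + 1))"
    have e: "e > 0" using r ab by (simp add: e_def)
    have "e * (2 * (b - a + 1)) = r" using ab by (simp add: e_def)
    moreover have "0 \<le> e * (b - a)" using e ab by simp
    moreover have "e * (2 * (b - a + 1)) = 2 * (e * (b - a)) + 2 * e" by algebra
    ultimately have er: "e * (b - a) < r" using e by linarith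
    show "\<forall>\<^sub>F i in sequentially. dist (Bochner_Integration.simple_bochner_integral ?M (s i)) (integral {a..b} f) < r"
      using unif[OF e]
    proof eventually_elim
      case (elim i)
      have "norm (integral {a..b} f - Bochner_Integration.simple_bochner_integral ?M (s i)) \<le> e * measure lborel {a..b}"
        using has_integral_diff[OF integrable_integral[OF fi] si[of i]] elim e
        by (intro has_integral_bound_real[where f="\<lambda>x. f x - s i x" and S="{}"]) auto
      also have "\<dots> < r"
        using ab er by simp
      finally show ?case by (simp add: dist_norm norm_minus_commute)
    qed
  qed
  ultimately show ?thesis
    unfolding has_bochner_def using fm sbi by blast
qed

section \<open>Weakly singular integrals\<close>

text \<open>Termwise differentiation. The theorem on sequences of derivatives supplies some limit
  function with derivative \<open>v\<close>; uniqueness of pointwise limits identifies it with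
  \<open>F\<close> on \<open>S\<close>.\<close>

lemma has_vector_derivative_uniform_limit:
  fixes F :: "real \<Rightarrow> 'a::banach"
  assumes S: "convex S"
    and der: "\<And>n t. t \<in> S \<Longrightarrow> (f n has_vector_derivative w n t) (at t within S)"
    and unif: "uniform_limit S w v sequentially"
    and lim: "\<And>t. t \<in> S \<Longrightarrow> (\<lambda>n. f n t) \<longlonglongrightarrow> F t"
    and t: "t \<in> S"
  shows "(F has_vector_derivative v t) (at t within S)"
proof -
  have "\<exists>g. \<forall>x\<in>S. (\<lambda>n. f n x) \<longlonglongrightarrow> g x \<and> (g has_derivative (\<lambda>h. h *\<^sub>R v x)) (at x within S)"
  proof (rule has_derivative_sequence[where f=f and f'="\<lambda>n x h. h *\<^sub>R w n x", OF S _ _ t lim[OF t]])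
    show "(f n has_derivative (\<lambda>h. h *\<^sub>R w n x)) (at x within S)" if "x \<in> S" for n x
      using der[OF that] by (simp add: has_vector_derivative_def)
    fix e :: real assume "e > 0"
    have "\<forall>\<^sub>F n in sequentially. \<forall>x\<in>S. dist (w n x) (v x) < e"
      using unif \<open>e > 0\<close> by (rule uniform_limitD)
    then show "\<forall>\<^sub>F n in sequentially. \<forall>x\<in>S. \<forall>h. norm (h *\<^sub>R w n x - h *\<^sub>R v x) \<le> e * norm h"
    proof eventually_elim
      case (elim n)
      show ?case
      proof (intro ballI allI)
        fix x and h :: real assume "x \<in> S"
        then have "norm (w n x - v x) \<le> e" using elim by (auto simp: dist_norm less_imp_le)
        then have "\<bar>h\<bar> * norm (w n x - v x) \<le> \<bar>h\<bar> * e" by (intro mult_left_mono) auto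
        then show "norm (h *\<^sub>R w n x - h *\<^sub>R v x) \<le> e * norm h"
          by (simp add: mult.commute flip: scaleR_diff_right)
      qed
    qed
  qed
  then obtain g where g: "\<And>x. x \<in> S \<Longrightarrow> (\<lambda>n. f n x) \<longlonglongrightarrow> g x"
      "\<And>x. x \<in> S \<Longrightarrow> (g has_derivative (\<lambda>h. h *\<^sub>R v x)) (at x within S)" by blast
  have "F x = g x" if "x \<in> S" for x
    using LIMSEQ_unique lim g(1) that by blast
  then show ?thesis
    unfolding has_vector_derivative_def
    using has_derivative_transform[OF t _ g(2)[OF t]] by blast
qed

text \<open>Error majorants are integrated by the fundamental theorem of calculus as gauge
  integrals; this carries the value over to the nonnegative integral used in the Bochner
  estimates.\<close>

lemma nn_integral_lebesgue_on_has_integral: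
  fixes e :: "real \<Rightarrow> real"
  assumes "\<And>x. 0 \<le> e x" "(e has_integral I) {a..b}"
  shows "(\<integral>\<^sup>+ x. ennreal (e x) \<partial>lebesgue_on {a..b}) = ennreal I"
proof -
  have "(\<integral>\<^sup>+ x. ennreal (e x) \<partial>lebesgue_on {a..b}) = (\<integral>\<^sup>+ x. ennreal (e x) * indicator {a..b} x \<partial>lebesgue)"
    by (subst nn_integral_restrict_space) auto
  also have "\<dots> = (\<integral>\<^sup>+ x. ennreal (indicator {a..b} x * e x) \<partial>lebesgue)"
    by (intro nn_integral_cong) (auto simp: indicator_def)
  also have "\<dots> = (\<integral>\<^sup>+ x. ennreal (indicator {a..b} x * e x) \<partial>lborel)"
    by (rule nn_integral_completion)
  also have "\<dots> = ennreal I"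
    by (rule nn_integral_has_integral_lebesgue[OF assms])
  finally show ?thesis .
qed

text \<open>The shift \<open>\<epsilon>\<close> removes the singularity of the kernel. Since \<open>g\<close> will vanish to the left of
  the base point, the range of integration can be kept independent of \<open>t\<close>, which makes
  differentiation under the integral sign applicable.\<close>

definition shifted_kernel_integral ::
  "real \<Rightarrow> real \<Rightarrow> real \<Rightarrow> (real \<Rightarrow> 'a::banach) \<Rightarrow> real \<Rightarrow> 'a" where
  "shifted_kernel_integral L \<alpha> \<epsilon> g t = integral {0..L} (\<lambda>u. (u + \<epsilon>) powr (- \<alpha>) *\<^sub>R g (t - u))"

text \<open>Since \<open>t - L \<le> t0\<close> and \<open>g\<close> vanishes to the left of
  \<open>t0\<close>, the range can be enlarged to \<open>{t-L..t}\<close>; the substitution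
  \<open>u = t - s\<close> then gives a range free of \<open>t\<close>.\<close>

lemma shifted_kernel_integral_eq:
  fixes g :: "real \<Rightarrow> 'a::banach"
  assumes g: "continuous_on UNIV g" and g0: "\<And>s. s \<le> t0 \<Longrightarrow> g s = 0"
    and t: "t0 \<le> t" "t \<le> t0 + L" and e: "\<epsilon> > 0"
  shows "integral {t0..t} (\<lambda>s. (t - s + \<epsilon>) powr (- \<alpha>) *\<^sub>R g s) = shifted_kernel_integral L \<alpha> \<epsilon> g t"
proof -
  note [continuous_intros] = continuous_on_compose2[OF g]
  let ?h = "\<lambda>s. (t - s + \<epsilon>) powr (- \<alpha>) *\<^sub>R g s"
  have c: "continuous_on {t-L..t} ?h"
    using e by (intro continuous_intros) auto
  have "integral {t0..t} ?h = integral {t-L..t} ?h"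
  proof (rule integral_spike_set)
    have "{x \<in> {t-L..t} - {t0..t}. ?h x \<noteq> 0} = {}" using g0 by auto
    then show "negligible {x \<in> {t-L..t} - {t0..t}. ?h x \<noteq> 0}" by (simp only: negligible_empty)
    have "{x \<in> {t0..t} - {t-L..t}. ?h x \<noteq> 0} = {}" using t by auto
    then show "negligible {x \<in> {t0..t} - {t-L..t}. ?h x \<noteq> 0}" by (simp only: negligible_empty)
  qed
  also have "\<dots> = shifted_kernel_integral L \<alpha> \<epsilon> g t"
  proof -
    have "(?h has_integral integral {t-L..t} ?h) {t-L..t}"
      using c by (intro integrable_integral integrable_continuous_real)
    then have "((\<lambda>x. ?h ((-1) *\<^sub>R x + t)) has_integral (1 / (\<bar>-1\<bar> ^ DIM(real))) *\<^sub>R integral {t-L..t} ?h)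
      ((\<lambda>x. (1 / (-1)) *\<^sub>R x + - ((1 / (-1)) *\<^sub>R t)) ` cbox (t-L) t)"
      by (intro has_integral_affinity) auto
    moreover have "(\<lambda>x. (1 / (-1)) *\<^sub>R x + - ((1 / (-1)) *\<^sub>R t)) ` cbox (t-L) t = {0..L}"
      by auto
    ultimately have "((\<lambda>u. (u + \<epsilon>) powr (- \<alpha>) *\<^sub>R g (t - u)) has_integral integral {t-L..t} ?h) {0..L}"
      by (simp add: algebra_simps)
    then show ?thesis unfolding shifted_kernel_integral_def by (simp add: integral_unique)
  qed
  finally show ?thesis .
qed

section \<open>Existence of Abel integrals and convergence of their regularisations\<close>

text \<open>The integrand need not be continuous at \<open>s = t\<close>. It is measurable
  piecewise: it is 0 at the point \<open>t\<close>, by the convention \<open>0 powr p = 0\<close>,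
  and continuous on the half-open rest.\<close>

lemma borel_measurable_singular_kernel:
  fixes g :: "real \<Rightarrow> 'a::banach"
  assumes g: "continuous_on {t0..t} g"
  shows "(\<lambda>s. (t - s) powr p *\<^sub>R g s) \<in> borel_measurable (lebesgue_on {t0..t})"
proof (rule measurable_piecewise_restrict[where C="{{t}, {t0..<t}}"])
  show "space (lebesgue_on {t0..t}) \<subseteq> \<Union> {{t}, {t0..<t}}" by auto
  fix \<Omega> assume "\<Omega> \<in> {{t}, {t0..<t}}"
  then have \<Omega>: "\<Omega> = {t} \<or> \<Omega> = {t0..<t}" by blast
  then show "\<Omega> \<inter> space (lebesgue_on {t0..t}) \<in> sets (lebesgue_on {t0..t})"
    by (auto simp: sets_restrict_space_iff)
  have r: "restrict_space (lebesgue_on {t0..t}) \<Omega> = lebesgue_on ({t0..t} \<inter> \<Omega>)"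
    using \<open>\<Omega> \<in> _\<close> by (intro restrict_restrict_space) auto
  show "(\<lambda>s. (t - s) powr p *\<^sub>R g s) \<in> borel_measurable (restrict_space (lebesgue_on {t0..t}) \<Omega>)"
    unfolding r using \<Omega>
  proof
    assume \<Omega>: "\<Omega> = {t}"
    have "(\<lambda>s. 0 :: 'a) \<in> borel_measurable (lebesgue_on ({t0..t} \<inter> \<Omega>))" by simp
    then show "(\<lambda>s. (t - s) powr p *\<^sub>R g s) \<in> borel_measurable (lebesgue_on ({t0..t} \<inter> \<Omega>))"
      by (rule measurable_cong[THEN iffD1, rotated]) (auto simp: \<Omega>)
  next
    assume \<Omega>: "\<Omega> = {t0..<t}"
    have int: "{t0..t} \<inter> {t0..<t} = {t0..<t}" by auto
    have "continuous_on {t0..<t} (\<lambda>s. (t - s) powr p *\<^sub>R g s)"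
      by (intro continuous_intros continuous_on_subset[OF g]) auto
    then show "(\<lambda>s. (t - s) powr p *\<^sub>R g s) \<in> borel_measurable (lebesgue_on ({t0..t} \<inter> \<Omega>))"
      unfolding \<Omega> int by (intro continuous_imp_measurable_on_sets_lebesgue) auto
  qed
qed simp

text \<open>The primitive is continuous on the closed interval but is differentiated only in the
  interior, because the kernel blows up at \<open>s = t\<close>. By monotonicity of
  \<open>powr\<close> the value is at most
  \<open>\<epsilon> powr (1 - \<alpha>) / (1 - \<alpha>)\<close>, which is the rate of convergence
  of the regularisation.\<close>

lemma has_integral_kernel_diff:
  fixes t t0 \<alpha> \<epsilon> :: real
  assumes "0 < \<alpha>" "\<alpha> < 1" "t0 \<le> t" "0 < \<epsilon>"
  shows "((\<lambda>s. (t - s) powr (- \<alpha>) - (t - s + \<epsilon>) powr (- \<alpha>)) has_integral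
    (\<epsilon> powr (1 - \<alpha>) + (t - t0) powr (1 - \<alpha>) - (t - t0 + \<epsilon>) powr (1 - \<alpha>)) / (1 - \<alpha>)) {t0..t}"
proof -
  define E where "E s = ((t - s + \<epsilon>) powr (1 - \<alpha>) - (t - s) powr (1 - \<alpha>)) / (1 - \<alpha>)" for s
  have "((\<lambda>s. (t - s) powr (- \<alpha>) - (t - s + \<epsilon>) powr (- \<alpha>)) has_integral (E t - E t0)) {t0..t}"
  proof (rule fundamental_theorem_of_calculus_interior[OF \<open>t0 \<le> t\<close>])
    show "continuous_on {t0..t} E"
      unfolding E_def using assms
      by (intro continuous_intros continuous_on_powr') auto
    fix s assume s: "s \<in> {t0<..<t}"
    have "((\<lambda>s. (t - s + \<epsilon>) powr (1 - \<alpha>) - (t - s) powr (1 - \<alpha>)) has_real_derivative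
        ((t - s) powr (- \<alpha>) - (t - s + \<epsilon>) powr (- \<alpha>)) * (1 - \<alpha>)) (at s)"
      using assms s by (auto intro!: derivative_eq_intros simp: algebra_simps)
    from DERIV_cdivide[OF this, of "1 - \<alpha>"]
    show "(E has_vector_derivative (t - s) powr (- \<alpha>) - (t - s + \<epsilon>) powr (- \<alpha>)) (at s)"
      unfolding E_def has_real_derivative_iff_has_vector_derivative[symmetric] using assms by simp
  qed
  then show ?thesis using assms by (simp add: E_def diff_divide_distrib add_divide_distrib algebra_simps)
qed

text \<open>The singular and the shifted integrand differ by at most \<open>B\<close> times the
  difference of the kernels, whose integral is small with \<open>\<epsilon>\<close>. So the
  regularised integrals form a Cauchy sequence, and their limit is the integral of the singular
  integrand.\<close>

lemma has_bochner_singular_kernel: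
  fixes g :: "real \<Rightarrow> 'a::banach"
  assumes g: "continuous_on UNIV g" and g0: "\<And>s. s \<le> t0 \<Longrightarrow> g s = 0"
    and t: "t0 \<le> t" "t \<le> t0 + L" and \<alpha>: "0 < \<alpha>" "\<alpha> < 1"
    and B: "\<And>s. s \<in> {t0..t} \<Longrightarrow> norm (g s) \<le> B"
  obtains x where "has_bochner (lebesgue_on {t0..t}) (\<lambda>s. (t - s) powr (- \<alpha>) *\<^sub>R g s) x"
    "\<And>\<epsilon>. \<epsilon> > 0 \<Longrightarrow> norm (x - shifted_kernel_integral L \<alpha> \<epsilon> g t) \<le> B * (\<epsilon> powr (1 - \<alpha>) / (1 - \<alpha>))"
proof -
  let ?M = "lebesgue_on {t0..t}"
  let ?k = "\<lambda>s. (t - s) powr (- \<alpha>) *\<^sub>R g s"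
  define h where "h \<epsilon> = (\<lambda>s. (t - s + \<epsilon>) powr (- \<alpha>) *\<^sub>R g s)" for \<epsilon>
  define c where "c \<epsilon> = B * (\<epsilon> powr (1 - \<alpha>) / (1 - \<alpha>))" for \<epsilon>
  \<comment> \<open>At \<open>s = t\<close> the singular kernel counts as 0, so the difference there
    has norm \<open>\<epsilon> powr (- \<alpha>) * norm (g t)\<close>; the second branch covers this
    point. Off the interval it only keeps \<open>e\<close> nonnegative, as the passage to the
    nonnegative integral requires.\<close>
  define e where "e \<epsilon> s = (if s \<in> {t0..<t} then B * ((t - s) powr (- \<alpha>) - (t - s + \<epsilon>) powr (- \<alpha>))
      else B * \<epsilon> powr (- \<alpha>))" for \<epsilon> s
  have B0: "0 \<le> B" using B[of t] t norm_ge_zero[of "g t"] by (simp del: norm_ge_zero)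
  have mono: "(t - s + \<epsilon>) powr (- \<alpha>) \<le> (t - s) powr (- \<alpha>)" if "s < t" "\<epsilon> > 0" for s \<epsilon>
    using that \<alpha> by (intro powr_mono2') auto
  have e0: "0 \<le> e \<epsilon> s" if "\<epsilon> > 0" for \<epsilon> s
    using B0 mono[of s \<epsilon>] that by (auto simp: e_def)
  have hb: "has_bochner ?M (h \<epsilon>) (shifted_kernel_integral L \<alpha> \<epsilon> g t)" if "\<epsilon> > 0" for \<epsilon>
  proof -
    have "continuous_on {t0..t} (h \<epsilon>)"
      unfolding h_def using that by (intro continuous_intros continuous_on_subset[OF g]) auto
    from has_bochner_continuous[OF t(1) this] show ?thesis
      using shifted_kernel_integral_eq[OF g g0 t that] by (simp add: h_def)
  qed
  have le: "norm (?k s - h \<epsilon> s) \<le> e \<epsilon> s" if "\<epsilon> > 0" "s \<in> {t0..t}" for \<epsilon> s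
  proof (cases "s = t")
    case True
    then show ?thesis using that B[of t] t by (simp add: h_def e_def mult.commute mult_right_mono)
  next
    case False
    then have "norm (?k s - h \<epsilon> s) = ((t - s) powr (- \<alpha>) - (t - s + \<epsilon>) powr (- \<alpha>)) * norm (g s)"
      using that mono[of s \<epsilon>] by (simp add: h_def flip: scaleR_diff_left)
    also have "\<dots> \<le> ((t - s) powr (- \<alpha>) - (t - s + \<epsilon>) powr (- \<alpha>)) * B"
      using that False mono[of s \<epsilon>] B by (intro mult_left_mono) auto
    finally show ?thesis using that False by (simp add: e_def mult.commute)
  qed
  define I where "I \<epsilon> = B * ((\<epsilon> powr (1 - \<alpha>) + (t - t0) powr (1 - \<alpha>) - (t - t0 + \<epsilon>) powr (1 - \<alpha>)) / (1 - \<alpha>))" for \<epsilon>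
  have ei: "(e \<epsilon> has_integral I \<epsilon>) {t0..t}" if "\<epsilon> > 0" for \<epsilon>
  proof (rule has_integral_spike_finite[where S="{t}"])
    show "((\<lambda>s. B * ((t - s) powr (- \<alpha>) - (t - s + \<epsilon>) powr (- \<alpha>))) has_integral I \<epsilon>) {t0..t}"
      unfolding I_def by (intro has_integral_mult_right has_integral_kernel_diff \<alpha> t that)
  qed (auto simp: e_def)
  have Ic: "I \<epsilon> \<le> c \<epsilon>" if "\<epsilon> > 0" for \<epsilon>
  proof -
    have "(t - t0) powr (1 - \<alpha>) \<le> (t - t0 + \<epsilon>) powr (1 - \<alpha>)"
      using that t \<alpha> by (intro powr_mono2) auto
    then show ?thesis unfolding I_def c_def using B0 \<alpha>
      by (intro mult_left_mono divide_right_mono) auto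
  qed
  have em: "e \<epsilon> \<in> borel_measurable ?M" if "\<epsilon> > 0" for \<epsilon>
    using ei[OF that] by (intro integrable_imp_measurable) (auto simp: integrable_on_def)
  have en: "(\<integral>\<^sup>+ s. ennreal (e \<epsilon> s) \<partial>?M) \<le> ennreal (c \<epsilon>)" if "\<epsilon> > 0" for \<epsilon>
    using nn_integral_lebesgue_on_has_integral[OF e0[OF that] ei[OF that]] Ic[OF that]
    by (simp add: ennreal_leI)
  have c0: "0 \<le> c \<epsilon>" for \<epsilon> using B0 \<alpha> by (simp add: c_def)
  define d where "d i = inverse (real (Suc i))" for i
  have d: "d i > 0" for i by (simp add: d_def)
  have dlim: "(\<lambda>i. c (d i)) \<longlonglongrightarrow> 0"
  proof -
    have "(\<lambda>i. d i powr (1 - \<alpha>)) \<longlonglongrightarrow> 0 powr (1 - \<alpha>)"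
      unfolding d_def using \<alpha> by (intro tendsto_powr' LIMSEQ_inverse_real_of_nat tendsto_const) auto
    then have "(\<lambda>i. B * (d i powr (1 - \<alpha>) / (1 - \<alpha>))) \<longlonglongrightarrow> B * (0 / (1 - \<alpha>))"
      using \<alpha> by (intro tendsto_intros) auto
    then show ?thesis by (simp add: c_def)
  qed
  let ?R = "\<lambda>i. shifted_kernel_integral L \<alpha> (d i) g t"
  have tri: "norm (a - b) \<le> norm (k - a) + norm (k - b)" for a b k :: 'a by norm
  \<comment> \<open>Both regularised integrands are compared with the singular one, so the sum of
    the two majorants bounds their distance.\<close>
  have diff: "norm (?R i - ?R j) \<le> c (d i) + c (d j)" for i j
  proof -
    have "ennreal (norm (?R i - ?R j)) \<le> (\<integral>\<^sup>+ s. ennreal (e (d i) s + e (d j) s) \<partial>?M)"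
    proof (rule has_bochner_diff_bound[OF hb[OF d] hb[OF d]])
      show "(\<lambda>s. e (d i) s + e (d j) s) \<in> borel_measurable ?M"
        using em[OF d] by (intro borel_measurable_add) auto
      fix s assume "s \<in> space ?M"
      then have "norm (?k s - h (d i) s) \<le> e (d i) s" "norm (?k s - h (d j) s) \<le> e (d j) s"
        using le[OF d] by auto
      then show "norm (h (d i) s - h (d j) s) \<le> e (d i) s + e (d j) s"
        using tri[of "h (d i) s" "h (d j) s" "?k s"] by linarith
    qed
    also have "\<dots> = (\<integral>\<^sup>+ s. ennreal (e (d i) s) + ennreal (e (d j) s) \<partial>?M)"
      using e0[OF d] by (intro nn_integral_cong) simp
    also have "\<dots> = (\<integral>\<^sup>+ s. ennreal (e (d i) s) \<partial>?M) + (\<integral>\<^sup>+ s. ennreal (e (d j) s) \<partial>?M)"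
      using em[OF d] by (intro nn_integral_add) auto
    also have "\<dots> \<le> ennreal (c (d i)) + ennreal (c (d j))"
      by (intro add_mono en d)
    also have "\<dots> = ennreal (c (d i) + c (d j))" using c0 by simp
    finally show ?thesis using ennreal_le_iff[OF add_nonneg_nonneg[OF c0 c0]] by blast
  qed
  have "Cauchy ?R"
  proof (rule metric_CauchyI)
    fix r :: real assume "r > 0"
    then have "\<forall>\<^sub>F i in sequentially. c (d i) < r / 2"
      using dlim by (intro order_tendstoD) auto
    then obtain N where N: "\<And>i. i \<ge> N \<Longrightarrow> c (d i) < r / 2"
      unfolding eventually_sequentially by blast
    then have "dist (?R i) (?R j) < r" if "i \<ge> N" "j \<ge> N" for i j
      using N[OF that(1)] N[OF that(2)] diff[of i j] unfolding dist_norm by linarith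
    then show "\<exists>N. \<forall>i\<ge>N. \<forall>j\<ge>N. dist (?R i) (?R j) < r" by blast
  qed
  then obtain x where x: "?R \<longlonglongrightarrow> x" by (metis Cauchy_convergent convergent_def)
  have km: "?k \<in> borel_measurable ?M"
    by (intro borel_measurable_singular_kernel continuous_on_subset[OF g]) auto
  have hx: "has_bochner ?M ?k x"
  proof (rule has_bochner_limit[OF km hb[OF d] em[OF d] _ _ x])
    show "norm (?k s - h (d i) s) \<le> e (d i) s" if "s \<in> space ?M" for i s
      using that by (intro le d) auto
    have clim: "(\<lambda>i. ennreal (c (d i))) \<longlonglongrightarrow> 0"
      using tendsto_ennrealI[OF dlim] by simp
    show "(\<lambda>i. \<integral>\<^sup>+ s. ennreal (e (d i) s) \<partial>?M) \<longlonglongrightarrow> 0"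
      by (rule tendsto_sandwich[OF _ _ tendsto_const clim]) (auto intro!: always_eventually en d)
  qed
  show thesis
  proof (rule that[OF hx])
    fix \<epsilon> :: real assume \<epsilon>: "\<epsilon> > 0"
    have "ennreal (norm (x - shifted_kernel_integral L \<alpha> \<epsilon> g t)) \<le> (\<integral>\<^sup>+ s. ennreal (e \<epsilon> s) \<partial>?M)"
      using le[OF \<epsilon>] by (intro has_bochner_diff_bound[OF hx hb[OF \<epsilon>] em[OF \<epsilon>]]) auto
    also have "\<dots> \<le> ennreal (c \<epsilon>)" by (rule en[OF \<epsilon>])
    finally show "norm (x - shifted_kernel_integral L \<alpha> \<epsilon> g t) \<le> B * (\<epsilon> powr (1 - \<alpha>) / (1 - \<alpha>))"
      using c0[of \<epsilon>] unfolding c_def by simp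
  qed
qed

text \<open>The Riemann-Liouville integral of order \<open>1 - \<alpha>\<close> without its factor
  \<open>1 / Gamma (1 - \<alpha>)\<close>.\<close>

definition abel_integral :: "real \<Rightarrow> real \<Rightarrow> (real \<Rightarrow> 'a::banach) \<Rightarrow> real \<Rightarrow> 'a" where
  "abel_integral \<alpha> t0 g t =
     bochner_integral (lebesgue_on {t0..t}) (\<lambda>s. (t - s) powr (- \<alpha>) *\<^sub>R g s)"

lemma abel_integral_cong:
  assumes "\<And>s. s \<in> {t0..t} \<Longrightarrow> f s = g s"
  shows "abel_integral \<alpha> t0 f t = abel_integral \<alpha> t0 g t"
proof -
  have "has_bochner (lebesgue_on {t0..t}) (\<lambda>s. (t - s) powr (- \<alpha>) *\<^sub>R f s) =
      has_bochner (lebesgue_on {t0..t}) (\<lambda>s. (t - s) powr (- \<alpha>) *\<^sub>R g s)"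
    using assms by (intro ext has_bochner_cong) simp
  then show ?thesis
    by (simp add: abel_integral_def bochner_integral_def bochner_integrable_def)
qed

lemma norm_abel_integral_diff_le:
  fixes g :: "real \<Rightarrow> 'a::banach"
  assumes g: "continuous_on UNIV g" and g0: "\<And>s. s \<le> t0 \<Longrightarrow> g s = 0"
    and t: "t0 \<le> t" "t \<le> t0 + L" and \<alpha>: "0 < \<alpha>" "\<alpha> < 1"
    and B: "\<And>s. s \<in> {t0..t} \<Longrightarrow> norm (g s) \<le> B" and \<epsilon>: "\<epsilon> > 0"
  shows "norm (abel_integral \<alpha> t0 g t - shifted_kernel_integral L \<alpha> \<epsilon> g t)
    \<le> B * (\<epsilon> powr (1 - \<alpha>) / (1 - \<alpha>))"
proof -
  obtain x where "has_bochner (lebesgue_on {t0..t}) (\<lambda>s. (t - s) powr (- \<alpha>) *\<^sub>R g s) x"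
    "\<And>\<epsilon>. \<epsilon> > 0 \<Longrightarrow> norm (x - shifted_kernel_integral L \<alpha> \<epsilon> g t) \<le> B * (\<epsilon> powr (1 - \<alpha>) / (1 - \<alpha>))"
    using has_bochner_singular_kernel[OF g g0 t \<alpha> B] by blast
  then show ?thesis
    using \<epsilon> by (simp add: abel_integral_def bochner_integral_eq)
qed

text \<open>The error bound depends on \<open>t\<close> only through a bound \<open>B\<close> for
  \<open>g\<close>, and compactness gives one \<open>B\<close> for the whole interval.\<close>

lemma uniform_limit_shifted_kernel_integral:
  fixes g :: "real \<Rightarrow> 'a::banach"
  assumes g: "continuous_on UNIV g" and g0: "\<And>s. s \<le> t0 \<Longrightarrow> g s = 0"
    and \<alpha>: "0 < \<alpha>" "\<alpha> < 1" and d: "\<And>i. d i > 0" "d \<longlonglongrightarrow> 0"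
  shows "uniform_limit {t0..t0 + L} (\<lambda>i. shifted_kernel_integral L \<alpha> (d i) g)
    (abel_integral \<alpha> t0 g) sequentially"
proof (rule uniform_limitI)
  fix e :: real assume "e > 0"
  have "compact (g ` {t0..t0 + L})"
    by (intro compact_continuous_image continuous_on_subset[OF g]) auto
  then have "bounded (g ` {t0..t0 + L})" by (rule compact_imp_bounded)
  then obtain B where "\<forall>y\<in>g ` {t0..t0 + L}. norm y \<le> B" unfolding bounded_iff ..
  then have B: "\<And>s. s \<in> {t0..t0 + L} \<Longrightarrow> norm (g s) \<le> B" by blast
  have "(\<lambda>i. d i powr (1 - \<alpha>)) \<longlonglongrightarrow> 0 powr (1 - \<alpha>)"
    using \<alpha> d by (intro tendsto_powr' tendsto_const) (auto intro!: always_eventually less_imp_le)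
  then have "(\<lambda>i. B * (d i powr (1 - \<alpha>) / (1 - \<alpha>))) \<longlonglongrightarrow> B * (0 / (1 - \<alpha>))"
    using \<alpha> by (intro tendsto_intros) auto
  then have "\<forall>\<^sub>F i in sequentially. B * (d i powr (1 - \<alpha>) / (1 - \<alpha>)) < e"
    using \<open>e > 0\<close> by (intro order_tendstoD) auto
  then show "\<forall>\<^sub>F i in sequentially. \<forall>t\<in>{t0..t0 + L}.
      dist (shifted_kernel_integral L \<alpha> (d i) g t) (abel_integral \<alpha> t0 g t) < e"
  proof eventually_elim
    case (elim i)
    show ?case
    proof
      fix t assume t: "t \<in> {t0..t0 + L}"
      have "norm (abel_integral \<alpha> t0 g t - shifted_kernel_integral L \<alpha> (d i) g t)
          \<le> B * (d i powr (1 - \<alpha>) / (1 - \<alpha>))"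
        using t by (intro norm_abel_integral_diff_le[OF g g0 _ _ \<alpha> B d(1)]) auto
      then show "dist (shifted_kernel_integral L \<alpha> (d i) g t) (abel_integral \<alpha> t0 g t) < e"
        using elim by (simp add: dist_norm norm_minus_commute)
    qed
  qed
qed

section \<open>Differentiation of regularised integrals\<close>

text \<open>The two-sided derivative at every real \<open>x\<close> comes from moving the base point
  to some \<open>c\<close> to the left of both \<open>t0\<close> and \<open>x\<close>. The integral
  does not change: \<open>g\<close> vanishes up to \<open>t0\<close>, and for \<open>y < t0\<close>
  the interval \<open>{t0..y}\<close> is empty, so its integral is 0 as well.\<close>

lemma antiderivative_of_vanishing:
  fixes g :: "real \<Rightarrow> 'a::banach"
  assumes g: "continuous_on UNIV g" and g0: "\<And>s. s \<le> t0 \<Longrightarrow> g s = 0"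
  shows "((\<lambda>x. integral {t0..x} g) has_vector_derivative g x) (at x)"
proof -
  define c where "c = min t0 x - 1"
  have gi: "g integrable_on {a..b}" for a b
    by (intro integrable_continuous_real continuous_on_subset[OF g]) auto
  have z: "integral {c..y} g = 0" if "y \<le> t0" for y
    using that g0 by (intro integral_unique has_integral_is_0) auto
  have eq: "integral {c..y} g = integral {t0..y} g" for y
  proof (cases "t0 \<le> y")
    case True
    have "integral {c..t0} g + integral {t0..y} g = integral {c..y} g"
      using True by (intro Henstock_Kurzweil_Integration.integral_combine gi) (auto simp: c_def)
    then show ?thesis using z[of t0] by simp
  next
    case False
    then show ?thesis using z[of y] by simp
  qed
  have "((\<lambda>y. integral {c..y} g) has_vector_derivative g x) (at x within {c..x + 1})"
    by (intro integral_has_vector_derivative continuous_on_subset[OF g]) (auto simp: c_def)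
  moreover have "at x within {c..x + 1} = at x"
    by (rule at_within_interior) (auto simp: c_def)
  ultimately show ?thesis by (simp add: eq)
qed

lemma shifted_kernel_integral_antiderivative:
  fixes g :: "real \<Rightarrow> 'a::banach"
  assumes g: "continuous_on UNIV g" and P: "\<And>x. (P has_vector_derivative g x) (at x)"
    and \<epsilon>: "\<epsilon> > 0"
  shows "(shifted_kernel_integral L \<alpha> \<epsilon> P has_vector_derivative
    shifted_kernel_integral L \<alpha> \<epsilon> g t) (at t)"
proof -
  have Pc: "continuous_on UNIV P"
    using P by (meson continuous_on_eq_continuous_at has_vector_derivative_continuous open_UNIV)
  note [continuous_intros] = continuous_on_compose2[OF g] continuous_on_compose2[OF Pc]
  have "((\<lambda>x. integral (cbox 0 L) (\<lambda>u. (u + \<epsilon>) powr (- \<alpha>) *\<^sub>R P (x - u))) has_vector_derivative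
      integral (cbox 0 L) (\<lambda>u. (u + \<epsilon>) powr (- \<alpha>) *\<^sub>R g (t - u))) (at t within UNIV)"
  proof (rule leibniz_rule_vector_derivative)
    fix x u :: real
    have "((P \<circ> (\<lambda>x. x - u)) has_vector_derivative 1 *\<^sub>R g (x - u)) (at x)"
      by (rule vector_diff_chain_at) (auto intro!: derivative_eq_intros P)
    from bounded_linear.has_vector_derivative[OF bounded_linear_scaleR_right this]
    show "((\<lambda>x. (u + \<epsilon>) powr (- \<alpha>) *\<^sub>R P (x - u)) has_vector_derivative
        (u + \<epsilon>) powr (- \<alpha>) *\<^sub>R g (x - u)) (at x within UNIV)"
      by (simp add: o_def)
  next
    fix x :: real
    show "(\<lambda>u. (u + \<epsilon>) powr (- \<alpha>) *\<^sub>R P (x - u)) integrable_on cbox 0 L"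
      unfolding cbox_interval using \<epsilon>
      by (intro integrable_continuous_real continuous_intros) auto
  next
    show "continuous_on (UNIV \<times> cbox 0 L) (\<lambda>(x, u). (u + \<epsilon>) powr (- \<alpha>) *\<^sub>R g (x - u))"
      unfolding split_beta using \<epsilon> by (intro continuous_intros) auto
  qed auto
  then show ?thesis by (simp add: shifted_kernel_integral_def[abs_def])
qed

lemma has_integral_shifted_kernel:
  fixes L \<alpha> \<epsilon> :: real
  assumes "0 \<le> L" "0 < \<epsilon>"
  shows "((\<lambda>u. \<alpha> * (u + \<epsilon>) powr (- \<alpha> - 1)) has_integral \<epsilon> powr (- \<alpha>) - (L + \<epsilon>) powr (- \<alpha>)) {0..L}"
proof -
  have "((\<lambda>u. \<alpha> * (u + \<epsilon>) powr (- \<alpha> - 1)) has_integral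
      (- ((L + \<epsilon>) powr (- \<alpha>))) - (- ((0 + \<epsilon>) powr (- \<alpha>)))) {0..L}"
  proof (rule fundamental_theorem_of_calculus[OF \<open>0 \<le> L\<close>])
    fix u assume "u \<in> {0..L}"
    then show "((\<lambda>u. - ((u + \<epsilon>) powr (- \<alpha>))) has_vector_derivative \<alpha> * (u + \<epsilon>) powr (- \<alpha> - 1)) (at u within {0..L})"
      unfolding has_real_derivative_iff_has_vector_derivative[symmetric] using assms
      by (auto intro!: derivative_eq_intros)
  qed
  then show ?thesis by simp
qed

text \<open>Marchaud's form of the fractional derivative, with the kernel shifted by \<open>\<epsilon>\<close>.\<close>

definition marchaud :: "real \<Rightarrow> real \<Rightarrow> real \<Rightarrow> (real \<Rightarrow> 'a::banach) \<Rightarrow> real \<Rightarrow> 'a" where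
  "marchaud L \<alpha> \<epsilon> g t = (L + \<epsilon>) powr (- \<alpha>) *\<^sub>R g t +
     integral {0..L} (\<lambda>u. (\<alpha> * (u + \<epsilon>) powr (- \<alpha> - 1)) *\<^sub>R (g t - g (t - u)))"

text \<open>As \<open>g\<close> need not be differentiable, the derivative is put on the kernel:
  integration by parts expresses the integral through the primitive \<open>P\<close> of
  \<open>g\<close>, and differentiating under the integral sign turns \<open>P\<close> back into
  \<open>g\<close>. Regrouping then produces the increments \<open>g t - g (t - u)\<close>.\<close>

lemma shifted_kernel_integral_has_derivative:
  fixes g :: "real \<Rightarrow> 'a::banach"
  assumes g: "continuous_on UNIV g" and g0: "\<And>s. s \<le> t0 \<Longrightarrow> g s = 0"
    and L: "0 < L" and \<epsilon>: "\<epsilon> > 0" and t: "t \<in> {t0..t0 + L}"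
  shows "(shifted_kernel_integral L \<alpha> \<epsilon> g has_vector_derivative marchaud L \<alpha> \<epsilon> g t)
    (at t within {t0..t0 + L})"
proof -
  define P where "P x = integral {t0..x} g" for x
  have P: "(P has_vector_derivative g x) (at x)" for x
    unfolding P_def by (rule antiderivative_of_vanishing[OF g g0])
  have P0: "P x = 0" if "x \<le> t0" for x
    unfolding P_def using g0 that by (intro integral_unique has_integral_is_0) auto
  have Pc: "continuous_on UNIV P"
    using P by (meson continuous_on_eq_continuous_at has_vector_derivative_continuous open_UNIV)
  note [continuous_intros] = continuous_on_compose2[OF g] continuous_on_compose2[OF Pc]
  \<comment> \<open>\<open>?k'\<close> is minus the derivative of \<open>?k\<close>, which keeps it
    nonnegative for positive \<open>\<alpha>\<close>.\<close>
  let ?k = "\<lambda>u. (u + \<epsilon>) powr (- \<alpha>)" and ?k' = "\<lambda>u. \<alpha> * (u + \<epsilon>) powr (- \<alpha> - 1)"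
  \<comment> \<open>The outcome of the integration by parts, with the boundary term at
    \<open>u = L\<close> already omitted.\<close>
  define Q where "Q x = \<epsilon> powr (- \<alpha>) *\<^sub>R P x - integral (cbox 0 L) (\<lambda>u. ?k' u *\<^sub>R P (x - u))" for x
  have dP: "((\<lambda>u. P (x - u)) has_vector_derivative - g (x - u)) (at u within S)" for x u S
  proof -
    have "((P \<circ> (\<lambda>u. x - u)) has_vector_derivative (-1) *\<^sub>R g (x - u)) (at u)"
      by (rule vector_diff_chain_at) (auto intro!: derivative_eq_intros P)
    then show ?thesis by (simp add: o_def has_vector_derivative_at_within)
  qed
  have QR: "shifted_kernel_integral L \<alpha> \<epsilon> g x = Q x" if x: "x \<in> {t0..t0 + L}" for x
  proof -
    have "((\<lambda>u. ?k u *\<^sub>R (- g (x - u)) + (- ?k' u) *\<^sub>R P (x - u)) has_integral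
        ?k L *\<^sub>R P (x - L) - ?k 0 *\<^sub>R P (x - 0)) {0..L}"
    proof (rule fundamental_theorem_of_calculus)
      fix u assume "u \<in> {0..L}"
      then have "(?k has_real_derivative - ?k' u) (at u within {0..L})"
        using \<epsilon> by (auto intro!: derivative_eq_intros)
      from has_vector_derivative_scaleR[OF this dP[of x u "{0..L}"]]
      show "((\<lambda>u. ?k u *\<^sub>R P (x - u)) has_vector_derivative
          ?k u *\<^sub>R (- g (x - u)) + (- ?k' u) *\<^sub>R P (x - u)) (at u within {0..L})" .
    qed (use L in simp)
    moreover have "((\<lambda>u. ?k' u *\<^sub>R P (x - u)) has_integral integral {0..L} (\<lambda>u. ?k' u *\<^sub>R P (x - u))) {0..L}"
      using \<epsilon> by (intro integrable_integral integrable_continuous_real continuous_intros) auto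
    ultimately have "((\<lambda>u. - ((?k u *\<^sub>R (- g (x - u)) + (- ?k' u) *\<^sub>R P (x - u)) + ?k' u *\<^sub>R P (x - u)))
        has_integral - ((?k L *\<^sub>R P (x - L) - ?k 0 *\<^sub>R P (x - 0)) + integral {0..L} (\<lambda>u. ?k' u *\<^sub>R P (x - u)))) {0..L}"
      by (intro has_integral_neg has_integral_add)
    \<comment> \<open>The boundary term at \<open>u = L\<close> vanishes because
      \<open>x - L \<le> t0\<close>.\<close>
    moreover have "P (x - L) = 0" using x by (intro P0) auto
    ultimately have "((\<lambda>u. ?k u *\<^sub>R g (x - u)) has_integral Q x) {0..L}"
      by (simp add: Q_def)
    then show ?thesis unfolding shifted_kernel_integral_def by (rule integral_unique)
  qed
  have "((\<lambda>x. integral (cbox 0 L) (\<lambda>u. ?k' u *\<^sub>R P (x - u))) has_vector_derivative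
      integral (cbox 0 L) (\<lambda>u. ?k' u *\<^sub>R g (t - u))) (at t within UNIV)"
  proof (rule leibniz_rule_vector_derivative)
    fix x u :: real
    have "((P \<circ> (\<lambda>x. x - u)) has_vector_derivative 1 *\<^sub>R g (x - u)) (at x)"
      by (rule vector_diff_chain_at) (auto intro!: derivative_eq_intros P)
    from bounded_linear.has_vector_derivative[OF bounded_linear_scaleR_right this]
    show "((\<lambda>x. ?k' u *\<^sub>R P (x - u)) has_vector_derivative ?k' u *\<^sub>R g (x - u)) (at x within UNIV)"
      by (simp add: o_def)
  next
    fix x :: real
    show "(\<lambda>u. ?k' u *\<^sub>R P (x - u)) integrable_on cbox 0 L"
      unfolding cbox_interval using \<epsilon>
      by (intro integrable_continuous_real continuous_intros) auto
  next
    show "continuous_on (UNIV \<times> cbox 0 L) (\<lambda>(x, u). ?k' u *\<^sub>R g (x - u))"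
      unfolding split_beta using \<epsilon> by (intro continuous_intros) auto
  qed auto
  then have "(Q has_vector_derivative \<epsilon> powr (- \<alpha>) *\<^sub>R g t - integral {0..L} (\<lambda>u. ?k' u *\<^sub>R g (t - u))) (at t)"
    unfolding Q_def[abs_def]
    by (intro has_vector_derivative_diff bounded_linear.has_vector_derivative[OF bounded_linear_scaleR_right] P) simp
  \<comment> \<open>The total mass of \<open>?k'\<close> is \<open>\<epsilon> powr (- \<alpha>) - (L
    + \<epsilon>) powr (- \<alpha>)\<close>. Hence the coefficient of \<open>g t\<close> splits into
    \<open>(L + \<epsilon>) powr (- \<alpha>)\<close> and this mass, which goes under the
    integral.\<close>
  moreover have "\<epsilon> powr (- \<alpha>) *\<^sub>R g t - integral {0..L} (\<lambda>u. ?k' u *\<^sub>R g (t - u)) = marchaud L \<alpha> \<epsilon> g t"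
  proof -
    have "((\<lambda>u. ?k' u *\<^sub>R g t) has_integral (\<epsilon> powr (- \<alpha>) - (L + \<epsilon>) powr (- \<alpha>)) *\<^sub>R g t) {0..L}"
      using L \<epsilon> by (intro has_integral_scaleR_left has_integral_shifted_kernel) auto
    moreover have "((\<lambda>u. ?k' u *\<^sub>R g (t - u)) has_integral integral {0..L} (\<lambda>u. ?k' u *\<^sub>R g (t - u))) {0..L}"
      using \<epsilon> by (intro integrable_integral integrable_continuous_real continuous_intros) auto
    ultimately have "((\<lambda>u. ?k' u *\<^sub>R g t - ?k' u *\<^sub>R g (t - u)) has_integral
        (\<epsilon> powr (- \<alpha>) - (L + \<epsilon>) powr (- \<alpha>)) *\<^sub>R g t - integral {0..L} (\<lambda>u. ?k' u *\<^sub>R g (t - u))) {0..L}"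
      by (rule has_integral_diff)
    then have "integral {0..L} (\<lambda>u. ?k' u *\<^sub>R (g t - g (t - u))) =
        (\<epsilon> powr (- \<alpha>) - (L + \<epsilon>) powr (- \<alpha>)) *\<^sub>R g t - integral {0..L} (\<lambda>u. ?k' u *\<^sub>R g (t - u))"
      by (simp add: integral_unique scaleR_diff_right)
    then show ?thesis by (simp add: marchaud_def scaleR_diff_left)
  qed
  ultimately have "(Q has_vector_derivative marchaud L \<alpha> \<epsilon> g t) (at t within {t0..t0 + L})"
    by (simp add: has_vector_derivative_at_within)
  then show ?thesis
    by (rule has_vector_derivative_transform[OF t, rotated]) (simp add: QR)
qed

text \<open>For a positive shift, differentiation and integration commute; both sides converge as
  the shift tends to 0, the derivatives uniformly.\<close>

lemma abel_integral_antiderivative: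
  fixes g :: "real \<Rightarrow> 'a::banach"
  assumes g: "continuous_on UNIV g" and g0: "\<And>s. s \<le> t0 \<Longrightarrow> g s = 0"
    and P: "\<And>x. (P has_vector_derivative g x) (at x)" and P0: "\<And>s. s \<le> t0 \<Longrightarrow> P s = 0"
    and \<alpha>: "0 < \<alpha>" "\<alpha> < 1" and t: "t \<in> {t0..t1}"
  shows "(abel_integral \<alpha> t0 P has_vector_derivative abel_integral \<alpha> t0 g t) (at t within {t0..t1})"
proof -
  define L where "L = t1 - t0"
  have L: "t1 = t0 + L" by (simp add: L_def)
  have Pc: "continuous_on UNIV P"
    using P by (meson continuous_on_eq_continuous_at has_vector_derivative_continuous open_UNIV)
  define d where "d = (\<lambda>i. inverse (real (Suc i)))"
  have d1: "d i > 0" for i by (simp add: d_def)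
  have d2: "d \<longlonglongrightarrow> 0" unfolding d_def by (rule LIMSEQ_inverse_real_of_nat)
  note d = d1 d2
  show ?thesis unfolding L
  proof (rule has_vector_derivative_uniform_limit)
    show "(shifted_kernel_integral L \<alpha> (d i) P has_vector_derivative
        shifted_kernel_integral L \<alpha> (d i) g t) (at t within {t0..t0 + L})" for i t
      by (rule has_vector_derivative_at_within[OF shifted_kernel_integral_antiderivative[OF g P d1]])
    show "uniform_limit {t0..t0 + L} (\<lambda>i. shifted_kernel_integral L \<alpha> (d i) g)
        (abel_integral \<alpha> t0 g) sequentially"
      by (rule uniform_limit_shifted_kernel_integral[OF g g0 \<alpha> d])
    show "(\<lambda>i. shifted_kernel_integral L \<alpha> (d i) P t) \<longlonglongrightarrow> abel_integral \<alpha> t0 P t"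
      if "t \<in> {t0..t0 + L}" for t
      using uniform_limit_shifted_kernel_integral[OF Pc P0 \<alpha> d] that
      by (rule tendsto_uniform_limitI)
  qed (use t L in auto)
qed

section \<open>Uniform convergence of the Marchaud expressions\<close>

text \<open>Dropping the shift enlarges the integrand to
  \<open>\<alpha> * u powr (\<beta> - \<alpha> - 1)\<close>, which may be singular at 0 but has the
  primitive \<open>\<alpha> / (\<beta> - \<alpha>) * u powr (\<beta> - \<alpha>)\<close>, continuous
  there since \<open>\<alpha> < \<beta>\<close>. The bound does not depend on
  \<open>\<epsilon>\<close>.\<close>

lemma integral_kernel_powr_le:
  fixes L \<alpha> \<beta> \<epsilon> :: real
  assumes \<alpha>: "0 < \<alpha>" "\<alpha> < \<beta>" and L: "0 \<le> L" and \<epsilon>: "\<epsilon> > 0"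
  shows "integral {0..L} (\<lambda>u. (\<alpha> * (u + \<epsilon>) powr (- \<alpha> - 1)) * u powr \<beta>) \<le> \<alpha> / (\<beta> - \<alpha>) * L powr (\<beta> - \<alpha>)"
proof -
  have "((\<lambda>u. \<alpha> * u powr (\<beta> - \<alpha> - 1)) has_integral
      \<alpha> / (\<beta> - \<alpha>) * L powr (\<beta> - \<alpha>) - \<alpha> / (\<beta> - \<alpha>) * 0 powr (\<beta> - \<alpha>)) {0..L}"
  proof (rule fundamental_theorem_of_calculus_interior[OF L])
    show "continuous_on {0..L} (\<lambda>u. \<alpha> / (\<beta> - \<alpha>) * u powr (\<beta> - \<alpha>))"
      using \<alpha> by (intro continuous_intros continuous_on_powr') auto
    fix u assume "u \<in> {0<..<L}"
    then have "((\<lambda>u. u powr (\<beta> - \<alpha>)) has_real_derivative (\<beta> - \<alpha>) * u powr (\<beta> - \<alpha> - 1)) (at u)"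
      by (auto intro!: derivative_eq_intros)
    from DERIV_cmult[OF this, of "\<alpha> / (\<beta> - \<alpha>)"]
    show "((\<lambda>u. \<alpha> / (\<beta> - \<alpha>) * u powr (\<beta> - \<alpha>)) has_vector_derivative \<alpha> * u powr (\<beta> - \<alpha> - 1)) (at u)"
      unfolding has_real_derivative_iff_has_vector_derivative[symmetric] using \<alpha> by simp
  qed
  then have I: "((\<lambda>u. \<alpha> * u powr (\<beta> - \<alpha> - 1)) has_integral \<alpha> / (\<beta> - \<alpha>) * L powr (\<beta> - \<alpha>)) {0..L}"
    by simp
  show ?thesis
  proof (rule has_integral_le[OF _ I])
    show "((\<lambda>u. (\<alpha> * (u + \<epsilon>) powr (- \<alpha> - 1)) * u powr \<beta>) has_integral
        integral {0..L} (\<lambda>u. (\<alpha> * (u + \<epsilon>) powr (- \<alpha> - 1)) * u powr \<beta>)) {0..L}"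
      using \<epsilon> \<alpha> by (intro integrable_integral integrable_continuous_real continuous_intros continuous_on_powr') auto
    fix u assume u: "u \<in> {0..L}"
    show "(\<alpha> * (u + \<epsilon>) powr (- \<alpha> - 1)) * u powr \<beta> \<le> \<alpha> * u powr (\<beta> - \<alpha> - 1)"
    proof (cases "u = 0")
      case False
      then have "(u + \<epsilon>) powr (- \<alpha> - 1) * u powr \<beta> \<le> u powr (- \<alpha> - 1) * u powr \<beta>"
        using u \<epsilon> \<alpha> by (intro mult_right_mono powr_mono2') auto
      also have "\<dots> = u powr (\<beta> - \<alpha> - 1)"
        by (simp add: algebra_simps flip: powr_add)
      finally show ?thesis using \<alpha> by (simp add: mult.assoc)
    qed (use \<alpha> in simp)
  qed
qed

text \<open>A smaller shift enlarges both coefficients of the Marchaud expression, so coefficient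
  differences are nonnegative and the expressions for shifts
  \<open>\<delta> \<le> \<epsilon>\<close> differ by at most
  \<open>M * (S \<delta> - S \<epsilon>)\<close>, whatever \<open>t\<close> is. The numbers
  \<open>M * S (d i)\<close> are increasing and bounded, hence Cauchy, and the expressions are
  uniformly Cauchy without any explicit rate.\<close>

lemma marchaud_uniform_limit:
  fixes g :: "real \<Rightarrow> 'a::banach"
  assumes g: "continuous_on UNIV g" and g0: "\<And>s. s \<le> t0 \<Longrightarrow> g s = 0"
    and hoelder: "\<And>x y. norm (g x - g y) \<le> M * \<bar>x - y\<bar> powr \<beta>"
    and \<alpha>: "0 < \<alpha>" "\<alpha> < \<beta>" and L: "0 < L"
    and d: "\<And>i. d i > 0" "decseq d"
  obtains v where "continuous_on {t0..t0 + L} v"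
    "uniform_limit {t0..t0 + L} (\<lambda>i. marchaud L \<alpha> (d i) g) v sequentially"
    "\<And>t. t \<in> {t0..t0 + L} \<Longrightarrow> norm (v t) \<le> M * (L powr (\<beta> - \<alpha>) * (1 + \<alpha> / (\<beta> - \<alpha>)))"
proof -
  define k where "k \<epsilon> u = \<alpha> * (u + \<epsilon>) powr (- \<alpha> - 1)" for \<epsilon> u :: real
  \<comment> \<open>The Marchaud expression with \<open>g t\<close> replaced by
    \<open>L powr \<beta>\<close> and the increment by \<open>u powr \<beta>\<close>, their bounds
    up to the factor \<open>M\<close>; \<open>K\<close> below bounds \<open>S\<close> for all
    positive shifts.\<close>
  define S where "S \<epsilon> = (L + \<epsilon>) powr (- \<alpha>) * L powr \<beta> + integral {0..L} (\<lambda>u. k \<epsilon> u * u powr \<beta>)" for \<epsilon>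
  define K where "K = L powr (\<beta> - \<alpha>) * (1 + \<alpha> / (\<beta> - \<alpha>))"
  note [continuous_intros] = continuous_on_compose2[OF g]
  \<comment> \<open>Two points at distance 1 give a lower bound for \<open>M\<close> itself.\<close>
  have "0 \<le> norm (g 1 - g 0)" by simp
  also have "\<dots> \<le> M" using hoelder[of 1 0] by simp
  finally have M: "0 \<le> M" .
  have gt: "norm (g t) \<le> M * L powr \<beta>" if t: "t \<in> {t0..t0 + L}" for t
  proof -
    have "norm (g t) \<le> M * \<bar>t - t0\<bar> powr \<beta>" using hoelder[of t t0] g0[of t0] by simp
    also have "\<dots> \<le> M * L powr \<beta>"
      using t \<alpha> M by (intro mult_left_mono powr_mono2) auto
    finally show ?thesis .
  qed
  have gu: "norm (g t - g (t - u)) \<le> M * u powr \<beta>" if "u \<in> {0..L}" for t u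
    using hoelder[of t "t - u"] that by simp
  have ki: "(\<lambda>u. k \<epsilon> u * u powr \<beta>) integrable_on {0..L}"
      "(\<lambda>u. k \<epsilon> u *\<^sub>R (g t - g (t - u))) integrable_on {0..L}" if "\<epsilon> > 0" for \<epsilon> t
    unfolding k_def using that \<alpha>
    by (intro integrable_continuous_real continuous_intros continuous_on_powr'; auto)+
  have kmono: "k \<epsilon> u \<le> k \<delta> u" if "0 < \<delta>" "\<delta> \<le> \<epsilon>" "u \<in> {0..L}" for \<delta> \<epsilon> u
    unfolding k_def using that \<alpha> by (intro mult_left_mono powr_mono2') auto
  have k0: "0 \<le> k \<epsilon> u" for \<epsilon> u using \<alpha> by (simp add: k_def)
  have pmono: "(L + \<epsilon>) powr (- \<alpha>) \<le> (L + \<delta>) powr (- \<alpha>)" if "0 \<le> \<delta>" "\<delta> \<le> \<epsilon>" for \<delta> \<epsilon>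
    using that \<alpha> L by (intro powr_mono2') auto
  have SK: "S \<epsilon> \<le> K" if "\<epsilon> > 0" for \<epsilon>
  proof -
    have "(L + \<epsilon>) powr (- \<alpha>) * L powr \<beta> \<le> (L + 0) powr (- \<alpha>) * L powr \<beta>"
      using that by (intro mult_right_mono pmono) auto
    also have "\<dots> = L powr (\<beta> - \<alpha>)" by (simp add: algebra_simps flip: powr_add)
    finally show ?thesis
      using integral_kernel_powr_le[OF \<alpha> less_imp_le[OF L] that]
      by (simp add: S_def K_def k_def algebra_simps)
  qed
  have diff: "norm (marchaud L \<alpha> \<delta> g t - marchaud L \<alpha> \<epsilon> g t) \<le> M * (S \<delta> - S \<epsilon>)"
    if \<delta>: "0 < \<delta>" "\<delta> \<le> \<epsilon>" and t: "t \<in> {t0..t0 + L}" for \<delta> \<epsilon> t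
  proof -
    have \<epsilon>: "0 < \<epsilon>" using \<delta> by simp
    have eq: "marchaud L \<alpha> \<delta> g t - marchaud L \<alpha> \<epsilon> g t = ((L + \<delta>) powr (- \<alpha>) - (L + \<epsilon>) powr (- \<alpha>)) *\<^sub>R g t
        + integral {0..L} (\<lambda>u. (k \<delta> u - k \<epsilon> u) *\<^sub>R (g t - g (t - u)))"
      using Henstock_Kurzweil_Integration.integral_diff[OF ki(2)[OF \<delta>(1), of t] ki(2)[OF \<epsilon>, of t]]
      by (simp add: marchaud_def k_def scaleR_diff_left)
    have "norm (integral {0..L} (\<lambda>u. (k \<delta> u - k \<epsilon> u) *\<^sub>R (g t - g (t - u))))
        \<le> integral {0..L} (\<lambda>u. M * (k \<delta> u * u powr \<beta> - k \<epsilon> u * u powr \<beta>))"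
    proof (rule Henstock_Kurzweil_Integration.integral_norm_bound_integral)
      show "(\<lambda>u. (k \<delta> u - k \<epsilon> u) *\<^sub>R (g t - g (t - u))) integrable_on {0..L}"
        using Henstock_Kurzweil_Integration.integrable_diff[OF ki(2)[OF \<delta>(1), of t] ki(2)[OF \<epsilon>, of t]] by (simp add: scaleR_diff_left)
      show "(\<lambda>u. M * (k \<delta> u * u powr \<beta> - k \<epsilon> u * u powr \<beta>)) integrable_on {0..L}"
        by (intro integrable_on_mult_right Henstock_Kurzweil_Integration.integrable_diff ki \<delta> \<epsilon>)
      fix u assume u: "u \<in> {0..L}"
      have "norm ((k \<delta> u - k \<epsilon> u) *\<^sub>R (g t - g (t - u))) = (k \<delta> u - k \<epsilon> u) * norm (g t - g (t - u))"
        using kmono[OF \<delta> u] by simp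
      also have "\<dots> \<le> (k \<delta> u - k \<epsilon> u) * (M * u powr \<beta>)"
        using kmono[OF \<delta> u] gu[OF u] by (intro mult_left_mono) auto
      finally show "norm ((k \<delta> u - k \<epsilon> u) *\<^sub>R (g t - g (t - u))) \<le> M * (k \<delta> u * u powr \<beta> - k \<epsilon> u * u powr \<beta>)"
        by (simp add: algebra_simps)
    qed
    also have "\<dots> = M * (integral {0..L} (\<lambda>u. k \<delta> u * u powr \<beta>) - integral {0..L} (\<lambda>u. k \<epsilon> u * u powr \<beta>))"
      using Henstock_Kurzweil_Integration.integral_diff[OF ki(1)[OF \<delta>(1)] ki(1)[OF \<epsilon>]] by simp
    finally have a: "norm (integral {0..L} (\<lambda>u. (k \<delta> u - k \<epsilon> u) *\<^sub>R (g t - g (t - u)))) \<le> \<dots>" .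
    have b: "norm (((L + \<delta>) powr (- \<alpha>) - (L + \<epsilon>) powr (- \<alpha>)) *\<^sub>R g t)
        \<le> ((L + \<delta>) powr (- \<alpha>) - (L + \<epsilon>) powr (- \<alpha>)) * (M * L powr \<beta>)"
      using pmono[of \<delta> \<epsilon>] \<delta> gt[OF t] by (auto intro!: mult_left_mono)
    show ?thesis
      unfolding eq S_def by (rule norm_triangle_le) (use a b in \<open>simp add: algebra_simps\<close>)
  qed
  have bound: "norm (marchaud L \<alpha> \<epsilon> g t) \<le> M * S \<epsilon>" if \<epsilon>: "0 < \<epsilon>" and t: "t \<in> {t0..t0 + L}" for \<epsilon> t
  proof -
    have "norm (integral {0..L} (\<lambda>u. k \<epsilon> u *\<^sub>R (g t - g (t - u)))) \<le> integral {0..L} (\<lambda>u. M * (k \<epsilon> u * u powr \<beta>))"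
    proof (rule Henstock_Kurzweil_Integration.integral_norm_bound_integral)
      fix u assume u: "u \<in> {0..L}"
      have "norm (k \<epsilon> u *\<^sub>R (g t - g (t - u))) \<le> k \<epsilon> u * (M * u powr \<beta>)"
        using k0 gu[OF u] by (auto intro!: mult_left_mono)
      then show "norm (k \<epsilon> u *\<^sub>R (g t - g (t - u))) \<le> M * (k \<epsilon> u * u powr \<beta>)"
        by (simp add: algebra_simps)
    qed (intro ki integrable_on_mult_right \<epsilon>)+
    moreover have "norm ((L + \<epsilon>) powr (- \<alpha>) *\<^sub>R g t) \<le> (L + \<epsilon>) powr (- \<alpha>) * (M * L powr \<beta>)"
      using gt[OF t] by (auto intro!: mult_left_mono)
    ultimately show ?thesis
      unfolding marchaud_def S_def k_def
      by (intro norm_triangle_le) (simp add: algebra_simps)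
  qed
  have dm: "d j \<le> d i" if "i \<le> j" for i j using d(2) that by (simp add: decseq_def)
  have "convergent (\<lambda>i. M * S (d i))"
  proof (rule Bseq_mono_convergent)
    have "M * S (d i) \<le> M * K" for i using SK[OF d(1)] M by (intro mult_left_mono)
    moreover have "0 \<le> M * S (d i)" for i
      using order_trans[OF norm_ge_zero bound[OF d(1)[of i], of t0]] L by simp
    ultimately show "Bseq (\<lambda>i. M * S (d i))" by (intro BseqI'[of _ "M * K"]) simp
    \<comment> \<open>Monotonicity is read off from \<open>diff\<close> at the single point
      \<open>t0\<close>, since a norm is nonnegative.\<close>
    show "\<forall>i j. i \<le> j \<longrightarrow> M * S (d i) \<le> M * S (d j)"
    proof (intro allI impI)
      fix i j :: nat assume that: "i \<le> j"
      have "0 \<le> norm (marchaud L \<alpha> (d j) g t0 - marchaud L \<alpha> (d i) g t0)" by simp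
      also have "\<dots> \<le> M * (S (d j) - S (d i))"
        using L by (intro diff d dm that) auto
      finally show "M * S (d i) \<le> M * S (d j)" by (simp add: algebra_simps)
    qed
  qed
  then have C: "Cauchy (\<lambda>i. M * S (d i))" by (rule convergent_Cauchy)
  have "uniformly_Cauchy_on {t0..t0 + L} (\<lambda>i. marchaud L \<alpha> (d i) g)"
  proof (rule uniformly_Cauchy_onI')
    fix e :: real assume "e > 0"
    then obtain N where N: "\<And>i j. i \<ge> N \<Longrightarrow> j \<ge> N \<Longrightarrow> dist (M * S (d i)) (M * S (d j)) < e"
      using metric_CauchyD[OF C] by blast
    have "dist (marchaud L \<alpha> (d i) g t) (marchaud L \<alpha> (d j) g t) < e"
      if "t \<in> {t0..t0 + L}" "i \<ge> N" "j > i" for t i j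
    proof -
      have "norm (marchaud L \<alpha> (d j) g t - marchaud L \<alpha> (d i) g t) \<le> M * (S (d j) - S (d i))"
        using that by (intro diff d dm) auto
      also have "\<dots> \<le> dist (M * S (d i)) (M * S (d j))" by (simp add: dist_real_def algebra_simps)
      also have "\<dots> < e" using that by (intro N) auto
      finally show ?thesis by (simp add: dist_norm norm_minus_commute)
    qed
    then show "\<exists>N. \<forall>x\<in>{t0..t0 + L}. \<forall>m\<ge>N. \<forall>n>m. dist (marchaud L \<alpha> (d m) g x) (marchaud L \<alpha> (d n) g x) < e"
      by blast
  qed
  then have "uniformly_convergent_on {t0..t0 + L} (\<lambda>i. marchaud L \<alpha> (d i) g)"
    by (rule Cauchy_uniformly_convergent)
  then obtain v where v: "uniform_limit {t0..t0 + L} (\<lambda>i. marchaud L \<alpha> (d i) g) v sequentially"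
    unfolding uniformly_convergent_on_def by blast
  show thesis
  proof (rule that[OF _ v])
    have "continuous_on {t0..t0 + L} (marchaud L \<alpha> (d i) g)" for i
    proof -
      have "continuous_on {t0..t0 + L} (\<lambda>t. integral (cbox 0 L) (\<lambda>u. (\<alpha> * (u + d i) powr (- \<alpha> - 1)) *\<^sub>R (g t - g (t - u))))"
      proof (rule integral_continuous_on_param)
        have "x + d i \<noteq> 0" if "0 \<le> x" for x using d(1)[of i] that by linarith
        then show "continuous_on ({t0..t0 + L} \<times> cbox 0 L) (\<lambda>(t, u). (\<alpha> * (u + d i) powr (- \<alpha> - 1)) *\<^sub>R (g t - g (t - u)))"
          unfolding split_beta by (intro continuous_intros) auto
      qed
      then show ?thesis
        unfolding marchaud_def[abs_def] cbox_interval by (intro continuous_intros continuous_on_subset[OF g]) auto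
    qed
    then show "continuous_on {t0..t0 + L} v"
      by (intro uniform_limit_theorem[OF _ v] always_eventually) auto
    fix t assume t: "t \<in> {t0..t0 + L}"
    have "(\<lambda>i. marchaud L \<alpha> (d i) g t) \<longlonglongrightarrow> v t" using v t by (rule tendsto_uniform_limitI)
    then show "norm (v t) \<le> M * (L powr (\<beta> - \<alpha>) * (1 + \<alpha> / (\<beta> - \<alpha>)))"
    proof (rule Lim_norm_ubound[rotated])
      have "norm (marchaud L \<alpha> (d i) g t) \<le> M * K" for i
        using bound[OF d(1) t] SK[OF d(1)[of i]] M by (meson mult_left_mono order_trans)
      then show "\<forall>\<^sub>F i in sequentially. norm (marchaud L \<alpha> (d i) g t) \<le> M * (L powr (\<beta> - \<alpha>) * (1 + \<alpha> / (\<beta> - \<alpha>)))"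
        by (auto simp: K_def)
    qed simp
  qed
qed

text \<open>The regularised integrals converge to the Abel integral because
  \<open>\<alpha> < 1\<close>, and their Marchaud derivatives converge uniformly to \<open>v\<close>
  because \<open>\<alpha> < \<beta>\<close>; so \<open>v\<close> is the derivative of the
  limit.\<close>

lemma abel_integral_hoelder:
  fixes g :: "real \<Rightarrow> 'a::banach"
  assumes g: "continuous_on UNIV g" and g0: "\<And>s. s \<le> t0 \<Longrightarrow> g s = 0"
    and hoelder: "\<And>x y. norm (g x - g y) \<le> M * \<bar>x - y\<bar> powr \<beta>"
    and \<alpha>: "0 < \<alpha>" "\<alpha> < \<beta>" "\<alpha> < 1" and t: "t0 < t1"
  obtains v where "continuous_on {t0..t1} v"
    "\<And>t. t \<in> {t0..t1} \<Longrightarrow> (abel_integral \<alpha> t0 g has_vector_derivative v t) (at t within {t0..t1})"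
    "\<And>t. t \<in> {t0..t1} \<Longrightarrow> norm (v t) \<le> M * ((t1 - t0) powr (\<beta> - \<alpha>) * (1 + \<alpha> / (\<beta> - \<alpha>)))"
proof -
  define L where "L = t1 - t0"
  have L: "t1 = t0 + L" "0 < L" using t by (simp_all add: L_def)
  define d where "d = (\<lambda>i. inverse (real (Suc i)))"
  have d1: "d i > 0" for i by (simp add: d_def)
  have d2: "d \<longlonglongrightarrow> 0" unfolding d_def by (rule LIMSEQ_inverse_real_of_nat)
  have d3: "decseq d" unfolding d_def decseq_def by (auto intro!: le_imp_inverse_le)
  note d = d1 d2 d3
  obtain v where v: "continuous_on {t0..t0 + L} v"
    "uniform_limit {t0..t0 + L} (\<lambda>i. marchaud L \<alpha> (d i) g) v sequentially"
    "\<And>t. t \<in> {t0..t0 + L} \<Longrightarrow> norm (v t) \<le> M * (L powr (\<beta> - \<alpha>) * (1 + \<alpha> / (\<beta> - \<alpha>)))"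
    using marchaud_uniform_limit[OF g g0 hoelder \<alpha>(1,2) L(2) d(1,3)] by blast
  show thesis
  proof (rule that[of v])
    fix t assume t: "t \<in> {t0..t1}"
    show "(abel_integral \<alpha> t0 g has_vector_derivative v t) (at t within {t0..t1})"
      unfolding L
    proof (rule has_vector_derivative_uniform_limit[OF _ _ v(2)])
      show "(shifted_kernel_integral L \<alpha> (d i) g has_vector_derivative marchaud L \<alpha> (d i) g t)
          (at t within {t0..t0 + L})" if "t \<in> {t0..t0 + L}" for i t
        by (rule shifted_kernel_integral_has_derivative[OF g g0 L(2) d(1) that])
      show "(\<lambda>i. shifted_kernel_integral L \<alpha> (d i) g t) \<longlonglongrightarrow> abel_integral \<alpha> t0 g t"
        if "t \<in> {t0..t0 + L}" for t
        using uniform_limit_shifted_kernel_integral[OF g g0 \<alpha>(1,3) d(1,2)] that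
        by (rule tendsto_uniform_limitI)
    qed (use t L in auto)
  qed (use v L in auto)
qed

section \<open>Weak derivatives\<close>

lemma test_function_derivs:
  assumes "\<phi> \<in> test_functions t0 t1"
  shows "((deriv ^^ j) \<phi> has_real_derivative (deriv ^^ Suc j) \<phi> t) (at t)"
proof -
  have "(deriv ^^ j) \<phi> differentiable (at t)"
    using assms by (auto simp: test_functions_def differentiable_on_def)
  then have "(deriv ^^ j) \<phi> field_differentiable (at t)"
    using field_differentiable_def real_differentiable_def by blast
  then show ?thesis
    using field_differentiable_derivI by simp
qed

text \<open>The complement of the support is open, so vanishing there passes from each derivative to
  the next; it contains every point outside \<open>{t0<..<t1}\<close>, in particular both end
  points.\<close>

lemma test_function_vanishes:
  assumes "\<phi> \<in> test_functions t0 t1" and t: "t \<notin> {t0<..<t1}"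
  shows "(deriv ^^ j) \<phi> t = 0"
proof -
  define U where "U = - closure {t. \<phi> t \<noteq> 0}"
  have U: "open U" unfolding U_def by (intro open_Compl closed_closure)
  have "(deriv ^^ j) \<phi> s = 0" if "s \<in> U" for s
    using that
  proof (induction j arbitrary: s)
    case 0
    then show ?case using closure_subset[of "{t. \<phi> t \<noteq> 0}"] by (auto simp: U_def)
  next
    case (Suc j)
    have "((\<lambda>_. 0) has_real_derivative 0) (at s)" by simp
    then have "((deriv ^^ j) \<phi> has_real_derivative 0) (at s)"
      by (rule has_field_derivative_transform_within_open[OF _ U]) (use Suc in auto)
    then show ?case by (simp add: DERIV_imp_deriv)
  qed
  moreover have "t \<in> U" using assms by (auto simp: U_def test_functions_def)
  ultimately show ?thesis .
qed

lemma test_function_continuous: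
  assumes "\<phi> \<in> test_functions t0 t1"
  shows "continuous_on S ((deriv ^^ j) \<phi>)"
  by (intro continuous_at_imp_continuous_on ballI DERIV_isCont[OF test_function_derivs[OF assms]])

lemma bochner_integral_continuous:
  fixes f :: "real \<Rightarrow> 'a::banach"
  assumes "a \<le> b" "continuous_on {a..b} f"
  shows "bochner_integral (lebesgue_on {a..b}) f = integral {a..b} f"
  by (rule bochner_integral_eq[OF has_bochner_continuous[OF assms]])

lemma locally_integrable_continuous:
  fixes g :: "real \<Rightarrow> 'a::banach"
  assumes "continuous_on {t0..t1} g"
  shows "locally_integrable t0 t1 g"
  unfolding locally_integrable_def bochner_integrable_def
proof (intro allI impI)
  fix a b assume ab: "t0 < a \<and> a \<le> b \<and> b < t1"
  then have "continuous_on {a..b} g" by (intro continuous_on_subset[OF assms]) auto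
  then show "\<exists>x. has_bochner (lebesgue_on {a..b}) g x" using ab has_bochner_continuous by blast
qed

text \<open>\<open>F\<close> lists the successive classical derivatives. Integrating by parts
  \<open>k\<close> times moves all derivatives from the test function to \<open>F 0\<close>; the
  boundary terms vanish with the test function, and each move contributes one sign.\<close>

lemma has_weak_deriv_classical:
  fixes F :: "nat \<Rightarrow> real \<Rightarrow> 'a::banach"
  assumes t: "t0 < t1"
    and F: "\<And>j t. \<lbrakk>j < k; t \<in> {t0..t1}\<rbrakk> \<Longrightarrow> (F j has_vector_derivative F (Suc j) t) (at t within {t0..t1})"
    and Fk: "continuous_on {t0..t1} (F k)"
  shows "has_weak_deriv t0 t1 k (F 0) (F k)"
proof -
  have Fc: "continuous_on {t0..t1} (F j)" if "j \<le> k" for j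
  proof (cases "j = k")
    case False
    then have "j < k" using that by simp
    then show ?thesis
      by (intro continuous_on_vector_derivative[OF F])
  qed (use Fk in simp)
  have "bochner_integral (lebesgue_on {t0..t1}) (\<lambda>t. (deriv ^^ k) \<phi> t *\<^sub>R F 0 t) =
      (-1) ^ k *\<^sub>R bochner_integral (lebesgue_on {t0..t1}) (\<lambda>t. \<phi> t *\<^sub>R F k t)"
    if \<phi>: "\<phi> \<in> test_functions t0 t1" for \<phi>
  proof -
    have c: "continuous_on {t0..t1} (\<lambda>t. (deriv ^^ i) \<phi> t *\<^sub>R F j t)" if "j \<le> k" for i j
      by (intro continuous_intros test_function_continuous[OF \<phi>] Fc that)
    have step: "integral {t0..t1} (\<lambda>t. (deriv ^^ Suc i) \<phi> t *\<^sub>R F j t) =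
        - integral {t0..t1} (\<lambda>t. (deriv ^^ i) \<phi> t *\<^sub>R F (Suc j) t)" if "j < k" for i j
    proof -
      have "((\<lambda>t. (deriv ^^ i) \<phi> t *\<^sub>R F (Suc j) t + (deriv ^^ Suc i) \<phi> t *\<^sub>R F j t) has_integral
          (deriv ^^ i) \<phi> t1 *\<^sub>R F j t1 - (deriv ^^ i) \<phi> t0 *\<^sub>R F j t0) {t0..t1}"
      proof (rule fundamental_theorem_of_calculus)
        fix s assume s: "s \<in> {t0..t1}"
        show "((\<lambda>t. (deriv ^^ i) \<phi> t *\<^sub>R F j t) has_vector_derivative
            (deriv ^^ i) \<phi> s *\<^sub>R F (Suc j) s + (deriv ^^ Suc i) \<phi> s *\<^sub>R F j s) (at s within {t0..t1})"
          by (rule has_vector_derivative_scaleR[OF has_field_derivative_at_within[OF test_function_derivs[OF \<phi>]] F[OF that s]])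
      qed (use t in simp)
      then have "integral {t0..t1} (\<lambda>t. (deriv ^^ i) \<phi> t *\<^sub>R F (Suc j) t + (deriv ^^ Suc i) \<phi> t *\<^sub>R F j t) = 0"
        using test_function_vanishes[OF \<phi>] by (simp del: funpow.simps add: integral_unique)
      then have "integral {t0..t1} (\<lambda>t. (deriv ^^ i) \<phi> t *\<^sub>R F (Suc j) t)
          + integral {t0..t1} (\<lambda>t. (deriv ^^ Suc i) \<phi> t *\<^sub>R F j t) = 0"
        using that by (subst (asm) Henstock_Kurzweil_Integration.integral_add)
          (intro integrable_continuous_real c; simp)+
      then show ?thesis by (simp del: funpow.simps add: add_eq_0_iff)
    qed
    \<comment> \<open>Here \<open>j\<close> counts the derivatives already moved.\<close>
    have "integral {t0..t1} (\<lambda>t. (deriv ^^ k) \<phi> t *\<^sub>R F 0 t) =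
        (-1) ^ j *\<^sub>R integral {t0..t1} (\<lambda>t. (deriv ^^ (k - j)) \<phi> t *\<^sub>R F j t)" if "j \<le> k" for j
      using that
    proof (induction j)
      case (Suc j)
      then have "k - j = Suc (k - Suc j)" by simp
      then show ?case using Suc step[of j "k - Suc j"] by (simp del: funpow.simps)
    qed simp
    from this[of k] show ?thesis
      using bochner_integral_continuous[OF less_imp_le[OF t] c[of 0 k]]
        bochner_integral_continuous[OF less_imp_le[OF t] c[of k 0]] by simp
  qed
  then show ?thesis
    unfolding has_weak_deriv_def using locally_integrable_continuous[OF Fc] by simp
qed

section \<open>Smooth bump functions\<close>

text \<open>The flat function exp(-1/x) times powers of 1/x; with these powers the linear span of
  the family is closed under differentiation.\<close>

definition flat_exp :: "nat \<Rightarrow> real \<Rightarrow> real" where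
  "flat_exp i x = (if x > 0 then inverse x ^ i * exp (- inverse x) else 0)"

lemma flat_exp_tendsto_0: "(flat_exp i \<longlongrightarrow> 0) (at_right 0)"
proof -
  have "((\<lambda>x::real. inverse x ^ i / exp (inverse x)) \<longlongrightarrow> 0) (at_right 0)"
    by (rule filterlim_compose[OF tendsto_power_div_exp_0 filterlim_inverse_at_top_right])
  then show ?thesis
    by (rule Lim_transform_eventually)
      (auto simp: flat_exp_def eventually_at_right_field exp_minus field_simps intro!: exI[of _ 1])
qed

lemma has_real_derivative_flat_exp:
  "(flat_exp i has_real_derivative flat_exp (i + 2) x - real i * flat_exp (i + 1) x) (at x)"
proof (cases x "0::real" rule: linorder_cases)
  case less
  have "((\<lambda>_. 0) has_real_derivative 0) (at x)" by simp
  then have "(flat_exp i has_real_derivative 0) (at x)"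
    by (rule has_field_derivative_transform_within_open[of _ _ _ "{..<0}"])
      (use less in \<open>auto simp: flat_exp_def\<close>)
  then show ?thesis using less by (simp add: flat_exp_def)
next
  case equal
  \<comment> \<open>From the right the difference quotient is \<open>flat_exp (Suc i) h\<close>,
    again a member of the family and tending to 0; from the left it is 0.\<close>
  have "((\<lambda>h. (flat_exp i (0 + h) - flat_exp i 0) / h) \<longlongrightarrow> 0) (at 0)"
  proof (rule filterlim_split_at)
    show "((\<lambda>h. (flat_exp i (0 + h) - flat_exp i 0) / h) \<longlongrightarrow> 0) (at_left 0)"
      by (rule Lim_transform_eventually[OF tendsto_const])
        (auto simp: flat_exp_def eventually_at_left_field intro!: exI[of _ "-1"])
    show "((\<lambda>h. (flat_exp i (0 + h) - flat_exp i 0) / h) \<longlongrightarrow> 0) (at_right 0)"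
      by (rule Lim_transform_eventually[OF flat_exp_tendsto_0[of "Suc i"]])
        (auto simp: flat_exp_def eventually_at_right_field divide_inverse intro!: exI[of _ 1])
  qed
  then show ?thesis using equal by (simp add: DERIV_def flat_exp_def)
next
  case greater
  have "((\<lambda>x. inverse x ^ i * exp (- inverse x)) has_real_derivative
      flat_exp (i + 2) x - real i * flat_exp (i + 1) x) (at x)"
  proof -
    \<comment> \<open>The power rule produces the truncated exponent \<open>i - Suc 0\<close>; for
      \<open>i = 0\<close> the factor \<open>real i\<close> makes both sides 0.\<close>
    have eq: "real i * (- (inverse x ^ Suc (Suc 0)) * inverse x ^ (i - Suc 0)) = - (real i * inverse x ^ (i + 1))"
      by (cases i) (auto simp: algebra_simps)
    have p: "((\<lambda>x. inverse x ^ i) has_real_derivative - (real i * inverse x ^ (i + 1))) (at x)"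
      unfolding eq[symmetric] by (intro DERIV_power DERIV_inverse) (use greater in simp)
    have e: "((\<lambda>x. exp (- inverse x)) has_real_derivative exp (- inverse x) * (inverse x * inverse x)) (at x)"
      using greater by (auto intro!: derivative_eq_intros)
    from DERIV_mult[OF p e] show ?thesis
      by (rule DERIV_cong) (use greater in \<open>simp add: flat_exp_def power_add algebra_simps\<close>)
  qed
  then show ?thesis
    by (rule has_field_derivative_transform_within_open[of _ _ _ "{0<..}"])
      (use greater in \<open>auto simp: flat_exp_def\<close>)
qed

text \<open>A family of functions containing a bump supported in \<open>[a, b]\<close> and closed under
  differentiation; hence all its members are smooth.\<close>

inductive_set bumps :: "real \<Rightarrow> real \<Rightarrow> (real \<Rightarrow> real) set" for a b where
  prod: "(\<lambda>t. flat_exp i (t - a) * flat_exp j (b - t)) \<in> bumps a b"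
| scale: "f \<in> bumps a b \<Longrightarrow> (\<lambda>t. c * f t) \<in> bumps a b"
| add: "f \<in> bumps a b \<Longrightarrow> g \<in> bumps a b \<Longrightarrow> (\<lambda>t. f t + g t) \<in> bumps a b"

lemma bumps_derivative:
  assumes "f \<in> bumps a b"
  shows "\<exists>f' \<in> bumps a b. \<forall>t. (f has_real_derivative f' t) (at t)"
  using assms
proof induction
  case (prod i j)
  \<comment> \<open>The product rule, written with explicit coefficients as a sum of scaled products
    so that it has the form of the closure rules of \<open>bumps\<close>.\<close>
  let ?f = "\<lambda>t. (1 * (flat_exp (i + 2) (t - a) * flat_exp j (b - t)) + (- real i) * (flat_exp (i + 1) (t - a) * flat_exp j (b - t)))
     + ((- 1) * (flat_exp i (t - a) * flat_exp (j + 2) (b - t)) + real j * (flat_exp i (t - a) * flat_exp (j + 1) (b - t)))"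
  have "?f \<in> bumps a b" by (intro bumps.add bumps.scale bumps.prod)
  moreover have "((\<lambda>t. flat_exp i (t - a) * flat_exp j (b - t)) has_real_derivative ?f t) (at t)" for t
  proof -
    have 1: "((\<lambda>t. flat_exp i (t - a)) has_real_derivative
        (flat_exp (i + 2) (t - a) - real i * flat_exp (i + 1) (t - a)) * 1) (at t)"
      by (rule DERIV_chain2[OF has_real_derivative_flat_exp]) (auto intro!: derivative_eq_intros)
    have 2: "((\<lambda>t. flat_exp j (b - t)) has_real_derivative
        (flat_exp (j + 2) (b - t) - real j * flat_exp (j + 1) (b - t)) * (-1)) (at t)"
      by (rule DERIV_chain2[OF has_real_derivative_flat_exp]) (auto intro!: derivative_eq_intros)
    from DERIV_mult[OF 1 2] show ?thesis by (rule DERIV_cong) (simp add: algebra_simps)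
  qed
  ultimately show ?case by (intro bexI[of _ ?f] allI)
next
  case (scale f c)
  then obtain f' where f': "f' \<in> bumps a b" "\<forall>t. (f has_real_derivative f' t) (at t)" by blast
  have "(\<lambda>t. c * f' t) \<in> bumps a b" by (rule bumps.scale[OF f'(1)])
  moreover have "\<forall>t. ((\<lambda>t. c * f t) has_real_derivative c * f' t) (at t)" using f' by (auto intro: DERIV_cmult)
  ultimately show ?case by (intro bexI[of _ "\<lambda>t. c * f' t"])
next
  case (add f g)
  then obtain f' g' where f': "f' \<in> bumps a b" "\<forall>t. (f has_real_derivative f' t) (at t)"
    and g': "g' \<in> bumps a b" "\<forall>t. (g has_real_derivative g' t) (at t)" by blast
  have "(\<lambda>t. f' t + g' t) \<in> bumps a b" by (rule bumps.add[OF f'(1) g'(1)])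
  moreover have "\<forall>t. ((\<lambda>t. f t + g t) has_real_derivative f' t + g' t) (at t)" using f' g' by (auto intro: DERIV_add)
  ultimately show ?case by (intro bexI[of _ "\<lambda>t. f' t + g' t"])
qed

text \<open>One flat factor vanishes to the left of \<open>a\<close>, the other to the right of
  \<open>b\<close>. All iterated derivatives stay in \<open>bumps\<close> and are therefore
  differentiable, and the support lies in \<open>{a..b}\<close>, inside the open interval.\<close>

lemma bump_test_function:
  assumes ab: "t0 < a" "a < b" "b < t1"
  obtains \<phi> where "\<phi> \<in> test_functions t0 t1" "\<And>t. 0 \<le> \<phi> t"
    "\<And>t. 0 < \<phi> t \<longleftrightarrow> t \<in> {a<..<b}"
proof
  define \<phi> where "\<phi> t = flat_exp 0 (t - a) * flat_exp 0 (b - t)" for t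
  show pos: "0 < \<phi> t \<longleftrightarrow> t \<in> {a<..<b}" "0 \<le> \<phi> t" for t
    by (auto simp: \<phi>_def flat_exp_def)
  have "(deriv ^^ j) \<phi> \<in> bumps a b" for j
  proof (induction j)
    case 0
    show ?case unfolding \<phi>_def[abs_def] by (simp add: bumps.prod)
  next
    case (Suc j)
    then obtain f' where "f' \<in> bumps a b" "\<forall>t. ((deriv ^^ j) \<phi> has_real_derivative f' t) (at t)"
      using bumps_derivative by blast
    moreover from this have "deriv ((deriv ^^ j) \<phi>) = f'" by (auto intro: DERIV_imp_deriv)
    ultimately show ?case by simp
  qed
  then have "(deriv ^^ j) \<phi> differentiable_on UNIV" for j
    using bumps_derivative unfolding differentiable_on_def
    by (meson real_differentiable_def)
  moreover have "closure {t. \<phi> t \<noteq> 0} \<subseteq> {a..b}"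
    by (rule closure_minimal) (auto simp: \<phi>_def flat_exp_def split: if_splits)
  ultimately show "\<phi> \<in> test_functions t0 t1"
    using ab by (auto simp: test_functions_def)
qed

section \<open>Uniqueness of continuous weak derivatives\<close>

text \<open>If \<open>w c \<noteq> 0\<close>, take a bump \<open>\<phi>\<close> living where
  \<open>w\<close> stays within \<open>norm (w c) / 2\<close> of \<open>w c\<close>. Replacing
  \<open>w\<close> by \<open>w c\<close> in the vanishing integral bounds the integral of
  \<open>\<phi>\<close> times \<open>norm (w c)\<close> by half of itself, so the integral of
  \<open>\<phi>\<close> is 0 and \<open>\<phi>\<close> vanishes at \<open>c\<close>, a
  contradiction. No functionals on the space are involved.\<close>

lemma fundamental_lemma_of_variations:
  fixes w :: "real \<Rightarrow> 'a::banach"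
  assumes t01: "t0 < t1" and w: "continuous_on {t0..t1} w"
    and zero: "\<And>\<phi>. \<phi> \<in> test_functions t0 t1 \<Longrightarrow> integral {t0..t1} (\<lambda>t. \<phi> t *\<^sub>R w t) = 0"
    and t: "t \<in> {t0..t1}"
  shows "w t = 0"
proof -
  have "w c = 0" if c: "c \<in> {t0<..<t1}" for c
  proof (rule ccontr)
    assume "w c \<noteq> 0"
    then obtain d where d: "d > 0" "\<And>t. \<lbrakk>t \<in> {t0..t1}; dist t c < d\<rbrakk> \<Longrightarrow> dist (w t) (w c) < norm (w c) / 2"
      using w c unfolding continuous_on_iff by (metis greaterThanLessThan_subseteq_atLeastAtMost_iff half_gt_zero in_mono order_refl zero_less_norm_iff)
    \<comment> \<open>Halving makes \<open>r\<close> strictly smaller than all three distances, so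
      \<open>{c - r..c + r}\<close> lies in the open interval.\<close>
    define r where "r = Min {d, c - t0, t1 - c} / 2"
    have r: "0 < r" "r < d" "r < c - t0" "r < t1 - c"
      using d c by (auto simp: r_def min_def)
    obtain \<phi> where \<phi>: "\<phi> \<in> test_functions t0 t1" and \<phi>0: "\<And>t. 0 \<le> \<phi> t"
        and \<phi>1: "\<And>t. 0 < \<phi> t \<longleftrightarrow> t \<in> {c - r<..<c + r}"
      using r by (elim bump_test_function[of t0 "c - r" "c + r" t1, rotated 3]) auto
    have \<phi>c: "continuous_on {t0..t1} \<phi>" using test_function_continuous[OF \<phi>, of _ 0] by simp
    have i1: "(\<lambda>t. \<phi> t *\<^sub>R w t) integrable_on {t0..t1}" "(\<lambda>t. \<phi> t *\<^sub>R w c) integrable_on {t0..t1}"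
        "\<phi> integrable_on {t0..t1}"
      by (intro integrable_continuous_real continuous_intros \<phi>c w)+
    have "integral {t0..t1} (\<lambda>t. \<phi> t *\<^sub>R w t - \<phi> t *\<^sub>R w c) = - (integral {t0..t1} \<phi> *\<^sub>R w c)"
      using Henstock_Kurzweil_Integration.integral_diff[OF i1(1,2)] zero[OF \<phi>]
        integral_unique[OF has_integral_scaleR_left[OF integrable_integral[OF i1(3)]], of "w c"] by simp
    then have "integral {t0..t1} \<phi> * norm (w c) \<le> norm (integral {t0..t1} (\<lambda>t. \<phi> t *\<^sub>R w t - \<phi> t *\<^sub>R w c))"
      by (simp add: mult_right_mono)
    also have "\<dots> \<le> integral {t0..t1} (\<lambda>t. \<phi> t * (norm (w c) / 2))"
    proof (rule Henstock_Kurzweil_Integration.integral_norm_bound_integral)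
      show "(\<lambda>t. \<phi> t *\<^sub>R w t - \<phi> t *\<^sub>R w c) integrable_on {t0..t1}"
        by (rule Henstock_Kurzweil_Integration.integrable_diff[OF i1(1,2)])
      show "(\<lambda>t. \<phi> t * (norm (w c) / 2)) integrable_on {t0..t1}"
        by (rule integrable_on_mult_left[OF i1(3)])
      fix t assume t: "t \<in> {t0..t1}"
      have "\<phi> t * norm (w t - w c) \<le> \<phi> t * (norm (w c) / 2)"
      proof (cases "\<phi> t = 0")
        case False
        then have "dist t c < d" using \<phi>1[of t] \<phi>0[of t] r by (auto simp: dist_real_def)
        then have "norm (w t - w c) \<le> norm (w c) / 2" using d(2)[OF t] by (simp add: dist_norm)
        then show ?thesis using \<phi>0 by (intro mult_left_mono)
      qed simp
      then show "norm (\<phi> t *\<^sub>R w t - \<phi> t *\<^sub>R w c) \<le> \<phi> t * (norm (w c) / 2)"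
        using \<phi>0[of t] by (simp flip: scaleR_diff_right)
    qed
    also have "\<dots> = integral {t0..t1} \<phi> * (norm (w c) / 2)" by simp
    finally have "integral {t0..t1} \<phi> * norm (w c) \<le> 0" by (simp add: mult.commute)
    moreover have "0 \<le> integral {t0..t1} \<phi>" by (rule Henstock_Kurzweil_Integration.integral_nonneg[OF i1(3)]) (rule \<phi>0)
    ultimately have "integral {t0..t1} \<phi> = 0" using \<open>w c \<noteq> 0\<close> by (simp add: mult_le_0_iff)
    then have "\<phi> c = 0"
      using integral_eq_0_iff[OF \<phi>c t01 \<phi>0] c by auto
    moreover have "0 < \<phi> c" unfolding \<phi>1 using r by simp
    ultimately show False by simp
  qed
  \<comment> \<open>The bump argument reaches interior points only; continuity extends the
    conclusion to the end points.\<close>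
  moreover have "closure {t0<..<t1} = {t0..t1}" using t01 by simp
  ultimately show ?thesis
    using continuous_constant_on_closure[of "{t0<..<t1}" w 0 t] w t by auto
qed

lemma has_weak_deriv_unique:
  fixes v1 v2 :: "real \<Rightarrow> 'a::banach"
  assumes t01: "t0 < t1"
    and "has_weak_deriv t0 t1 k g v1" "has_weak_deriv t0 t1 k g v2"
    and c: "continuous_on {t0..t1} v1" "continuous_on {t0..t1} v2"
    and t: "t \<in> {t0..t1}"
  shows "v1 t = v2 t"
proof -
  have "v1 t - v2 t = 0"
  proof (rule fundamental_lemma_of_variations[OF t01 _ _ t])
    show "continuous_on {t0..t1} (\<lambda>t. v1 t - v2 t)" by (intro continuous_intros c)
    fix \<phi> assume \<phi>: "\<phi> \<in> test_functions t0 t1"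
    have pc: "continuous_on {t0..t1} (\<lambda>t. \<phi> t *\<^sub>R v1 t)" "continuous_on {t0..t1} (\<lambda>t. \<phi> t *\<^sub>R v2 t)"
      using test_function_continuous[OF \<phi>, of _ 0] by (auto intro!: continuous_intros c)
    have e: "bochner_integral (lebesgue_on {t0..t1}) (\<lambda>t. (deriv ^^ k) \<phi> t *\<^sub>R g t) =
        (-1) ^ k *\<^sub>R bochner_integral (lebesgue_on {t0..t1}) (\<lambda>t. \<phi> t *\<^sub>R v t)"
      if "has_weak_deriv t0 t1 k g v" for v
      using that \<phi> unfolding has_weak_deriv_def by blast
    have "bochner_integral (lebesgue_on {t0..t1}) (\<lambda>t. \<phi> t *\<^sub>R v1 t) =
        bochner_integral (lebesgue_on {t0..t1}) (\<lambda>t. \<phi> t *\<^sub>R v2 t)"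
      using trans[OF e[OF assms(2), symmetric] e[OF assms(3)]] by simp
    then have "integral {t0..t1} (\<lambda>t. \<phi> t *\<^sub>R v1 t) = integral {t0..t1} (\<lambda>t. \<phi> t *\<^sub>R v2 t)"
      using t01 by (simp add: bochner_integral_continuous pc)
    then show "integral {t0..t1} (\<lambda>t. \<phi> t *\<^sub>R (v1 t - v2 t)) = 0"
      using Henstock_Kurzweil_Integration.integral_diff[OF integrable_continuous_real[OF pc(1)] integrable_continuous_real[OF pc(2)]]
      by (simp add: scaleR_diff_right)
  qed
  then show ?thesis by simp
qed

section \<open>Riemann-Liouville derivatives\<close>

lemma nth_deriv_has_vector_derivative:
  assumes "f \<in> C_space n t0 t1" "j < n" "t \<in> {t0..t1}"
  shows "(nth_deriv t0 t1 j f has_vector_derivative nth_deriv t0 t1 (Suc j) f t) (at t within {t0..t1})"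
  using assms by (simp add: C_space_def differentiable_on_def vector_derivative_works)

lemma continuous_on_nth_deriv:
  assumes "f \<in> C_space n t0 t1" "j \<le> n"
  shows "continuous_on {t0..t1} (nth_deriv t0 t1 j f)"
proof (cases "j = n")
  case True
  then show ?thesis using assms by (simp add: C_space_def)
next
  case False
  then have "nth_deriv t0 t1 j f differentiable_on {t0..t1}"
    using assms by (simp add: C_space_def)
  then show ?thesis by (rule differentiable_imp_continuous_on)
qed

section \<open>Commuting the Abel integral with derivatives\<close>

text \<open>The kernel lemmas concern functions on the whole line. Clamping the argument keeps the
  values on the interval, and the extension vanishes to the left of \<open>t0\<close> as soon as
  \<open>h t0 = 0\<close>.\<close>

lemma continuous_on_constant_extension:
  fixes h :: "real \<Rightarrow> 'a::banach"
  assumes "continuous_on {t0..t1} h" "t0 \<le> t1"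
  shows "continuous_on UNIV (\<lambda>t. h (max t0 (min t1 t)))"
  using assms(2) by (intro continuous_on_compose2[OF assms(1)] continuous_intros) auto

text \<open>The clamped extension of \<open>f'\<close> vanishes to the left of \<open>t0\<close>
  because \<open>f' t0 = 0\<close>, and its primitive from \<open>t0\<close> is \<open>f\<close> on
  the interval because \<open>f t0 = 0\<close>. Abel integrals see only values on the interval, so
  the result for primitives carries over.\<close>

lemma abel_integral_of_derivative:
  fixes f f' :: "real \<Rightarrow> 'a::banach"
  assumes der: "\<And>t. t \<in> {t0..t1} \<Longrightarrow> (f has_vector_derivative f' t) (at t within {t0..t1})"
    and c: "continuous_on {t0..t1} f'" and z: "f t0 = 0" "f' t0 = 0"
    and \<alpha>: "0 < \<alpha>" "\<alpha> < 1" and t: "t \<in> {t0..t1}"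
  shows "(abel_integral \<alpha> t0 f has_vector_derivative abel_integral \<alpha> t0 f' t) (at t within {t0..t1})"
proof -
  define g where "g t = f' (max t0 (min t1 t))" for t
  define P where "P x = integral {t0..x} g" for x
  have t01: "t0 \<le> t1" using t by simp
  have gc: "continuous_on UNIV g"
    unfolding g_def by (rule continuous_on_constant_extension[OF c t01])
  have g0: "g s = 0" if "s \<le> t0" for s using that z t01 by (simp add: g_def min_def)
  have gf: "g s = f' s" if "s \<in> {t0..t1}" for s using that by (simp add: g_def)
  have P: "(P has_vector_derivative g x) (at x)" for x
    unfolding P_def by (rule antiderivative_of_vanishing[OF gc g0])
  have P0: "P x = 0" if "x \<le> t0" for x
    unfolding P_def using g0 that by (intro integral_unique has_integral_is_0) auto
  have Pf: "P x = f x" if x: "x \<in> {t0..t1}" for x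
  proof -
    have "(f' has_integral f x - f t0) {t0..x}"
    proof (rule fundamental_theorem_of_calculus)
      fix s assume "s \<in> {t0..x}"
      then show "(f has_vector_derivative f' s) (at s within {t0..x})"
        using x by (intro has_vector_derivative_within_subset[OF der]) auto
    qed (use x in simp)
    then have "(g has_integral f x - f t0) {t0..x}"
      by (rule has_integral_eq[rotated]) (use x gf in auto)
    then show ?thesis using z by (simp add: P_def integral_unique)
  qed
  have "(abel_integral \<alpha> t0 P has_vector_derivative abel_integral \<alpha> t0 g t) (at t within {t0..t1})"
    by (rule abel_integral_antiderivative[OF gc g0 P P0 \<alpha> t])
  moreover have "abel_integral \<alpha> t0 g t = abel_integral \<alpha> t0 f' t"
    using t gf by (intro abel_integral_cong) auto
  moreover have "abel_integral \<alpha> t0 f s = abel_integral \<alpha> t0 P s" if "s \<in> {t0..t1}" for s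
    using that Pf by (intro abel_integral_cong) auto
  ultimately show ?thesis
    using has_vector_derivative_transform[OF t] by metis
qed

lemma ceiling_nat_plus:
  fixes \<alpha> :: real
  assumes "0 < \<alpha>" "\<alpha> < 1"
  shows "\<lceil>real n + \<alpha>\<rceil> = int n + 1"
  using assms by (intro ceiling_unique) auto

lemma RL_integral_eq_abel_integral:
  assumes "\<alpha> < 1"
  shows "RL_integral (1 - \<alpha>) t0 f = (\<lambda>t. (1 / Gamma (1 - \<alpha>)) *\<^sub>R abel_integral \<alpha> t0 f t)"
  using assms by (simp add: fun_eq_iff RL_integral_def abel_integral_def)

text \<open>The order \<open>n + \<alpha>\<close> means \<open>n + 1\<close> weak derivatives of the
  integral of order \<open>1 - \<alpha>\<close>. The first \<open>n\<close> pass under the Abel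
  integral thanks to the zero initial values; the last is the classical derivative supplied as
  \<open>v\<close>.\<close>

lemma has_RL_derivI:
  fixes f v :: "real \<Rightarrow> 'a::banach"
  assumes t01: "t0 < t1" and \<alpha>: "0 < \<alpha>" "\<alpha> < 1"
    and f: "f \<in> C_space n t0 t1" and f0: "\<And>j. j \<le> n \<Longrightarrow> nth_deriv t0 t1 j f t0 = 0"
    and v: "continuous_on {t0..t1} v"
    and der: "\<And>t. t \<in> {t0..t1} \<Longrightarrow>
      (abel_integral \<alpha> t0 (nth_deriv t0 t1 n f) has_vector_derivative v t) (at t within {t0..t1})"
  shows "has_RL_deriv (real n + \<alpha>) t0 t1 f (\<lambda>t. (1 / Gamma (1 - \<alpha>)) *\<^sub>R v t)"
proof -
  let ?c = "1 / Gamma (1 - \<alpha>)"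
  \<comment> \<open>The tower of classical derivatives, with the Gamma factor included; its top
    member \<open>F (Suc n)\<close> is the multiple of \<open>v\<close>.\<close>
  define F where "F j = (\<lambda>t. ?c *\<^sub>R (if j \<le> n then abel_integral \<alpha> t0 (nth_deriv t0 t1 j f) t else v t))" for j
  have "has_weak_deriv t0 t1 (Suc n) (F 0) (F (Suc n))"
  proof (rule has_weak_deriv_classical[OF t01])
    show "continuous_on {t0..t1} (F (Suc n))"
      unfolding F_def by (auto intro!: continuous_intros v)
    fix j t assume j: "j < Suc n" and t: "t \<in> {t0..t1}"
    have "(abel_integral \<alpha> t0 (nth_deriv t0 t1 j f) has_vector_derivative
        (if Suc j \<le> n then abel_integral \<alpha> t0 (nth_deriv t0 t1 (Suc j) f) t else v t)) (at t within {t0..t1})"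
    proof (cases "j = n")
      case True
      then show ?thesis using der[OF t] by simp
    next
      case False
      then have jn: "j < n" using j by simp
      have "(abel_integral \<alpha> t0 (nth_deriv t0 t1 j f) has_vector_derivative
          abel_integral \<alpha> t0 (nth_deriv t0 t1 (Suc j) f) t) (at t within {t0..t1})"
        by (rule abel_integral_of_derivative[OF nth_deriv_has_vector_derivative[OF f jn]
            continuous_on_nth_deriv[OF f] f0 f0 \<alpha> t]) (use jn in auto)
      then show ?thesis using jn by (simp del: nth_deriv.simps)
    qed
    from bounded_linear.has_vector_derivative[OF bounded_linear_scaleR_right this, of ?c]
    show "(F j has_vector_derivative F (Suc j) t) (at t within {t0..t1})"
      using j by (simp del: nth_deriv.simps add: F_def)
  qed
  moreover have "F 0 = RL_integral (1 - \<alpha>) t0 f"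
    using \<alpha> by (simp add: F_def RL_integral_eq_abel_integral)
  moreover have "F (Suc n) = (\<lambda>t. ?c *\<^sub>R v t)" by (simp add: F_def)
  moreover have "real_of_int \<lceil>real n + \<alpha>\<rceil> - (real n + \<alpha>) = 1 - \<alpha>" "nat \<lceil>real n + \<alpha>\<rceil> = Suc n"
    by (simp_all add: ceiling_nat_plus[OF \<alpha>])
  ultimately show ?thesis unfolding has_RL_deriv_def by (simp only:)
qed

lemma C_space_0: "v \<in> C_space 0 t0 t1 \<longleftrightarrow> continuous_on {t0..t1} v"
  by (simp add: C_space_def)

lemma RL_spaceI:
  assumes "0 < \<alpha>" "\<alpha> < 1" "f \<in> C_space n t0 t1"
    and "continuous_on {t0..t1} v" "has_RL_deriv (real n + \<alpha>) t0 t1 f v"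
  shows "f \<in> RL_space (real n + \<alpha>) t0 t1"
  using assms unfolding RL_space_def by (auto simp: ceiling_nat_plus C_space_0 nat_add_distrib)

text \<open>Any continuous representative is a witness for the choice operator, and uniqueness of
  continuous weak derivatives fixes the chosen one on the interval.\<close>

lemma RL_deriv_eq:
  assumes t01: "t0 < t1" and v: "continuous_on {t0..t1} v" "has_RL_deriv \<gamma> t0 t1 f v"
    and t: "t \<in> {t0..t1}"
  shows "RL_deriv \<gamma> t0 t1 f t = v t"
proof -
  have "RL_deriv \<gamma> t0 t1 f \<in> C_space 0 t0 t1 \<and> has_RL_deriv \<gamma> t0 t1 f (RL_deriv \<gamma> t0 t1 f)"
    unfolding RL_deriv_def by (rule someI[of _ v]) (simp add: C_space_0 v)
  then show ?thesis
    using has_weak_deriv_unique[OF t01 _ _ _ v(1) t] v(2) unfolding has_RL_deriv_def C_space_0 by blast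
qed

lemma bdd_above_norm_continuous:
  fixes f :: "real \<Rightarrow> 'a::banach"
  assumes "continuous_on {t0..t1} f"
  shows "bdd_above ((\<lambda>t. norm (f t)) ` {t0..t1})"
  by (intro bounded_imp_bdd_above compact_imp_bounded compact_continuous_image continuous_intros assms) auto

lemma C_norm_nonneg:
  assumes "f \<in> C_space n t0 t1" "t0 \<le> t1"
  shows "0 \<le> C_norm n t0 t1 f"
  unfolding C_norm_def
proof (rule sum_nonneg)
  fix j assume "j \<in> {0..n}"
  then have "bdd_above ((\<lambda>t. norm (nth_deriv t0 t1 j f t)) ` {t0..t1})"
    using assms by (intro bdd_above_norm_continuous continuous_on_nth_deriv) auto
  then show "0 \<le> (SUP t\<in>{t0..t1}. norm (nth_deriv t0 t1 j f t))"
    using assms(2) by (intro cSUP_upper2[of _ _ t0]) auto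
qed

section \<open>Derivatives and Abel integrals of shifted powers\<close>

lemma has_real_derivative_powr_shift:
  fixes t0 t1 t q :: real
  assumes t: "t \<in> {t0..t1}" and q: "1 < q"
  shows "((\<lambda>t. (t - t0) powr q) has_real_derivative q * (t - t0) powr (q - 1)) (at t within {t0..t1})"
proof (cases "t = t0")
  case True
  \<comment> \<open>At the base point the difference quotient is itself
    \<open>(s - t0) powr (q - 1)\<close>, which tends to 0 because \<open>q > 1\<close>.\<close>
  have "((\<lambda>s. (s - t0) powr (q - 1)) \<longlongrightarrow> (t0 - t0) powr (q - 1)) (at t0 within {t0..t1})"
    using q by (intro tendsto_powr' tendsto_intros) (auto simp: eventually_at intro!: exI[of _ 1])
  then have lim: "((\<lambda>s. (s - t0) powr (q - 1)) \<longlongrightarrow> 0) (at t0 within {t0..t1})"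
    using q by simp
  have "((\<lambda>s. ((s - t0) powr q - (t0 - t0) powr q) / (s - t0)) \<longlongrightarrow> 0) (at t0 within {t0..t1})"
    by (rule Lim_transform_eventually[OF lim])
      (auto simp: eventually_at powr_diff intro!: exI[of _ 1])
  then show ?thesis using True by (simp add: has_field_derivative_iff)
next
  case False
  then have "t0 < t" using t by simp
  then have "((\<lambda>t. (t - t0) powr q) has_real_derivative q * (t - t0) powr (q - 1)) (at t)"
    by (auto intro!: derivative_eq_intros)
  then show ?thesis by (rule has_field_derivative_at_within)
qed

lemma nth_deriv_powr:
  fixes x :: "'a::banach" and n :: nat
  assumes t01: "t0 < t1" and \<alpha>: "0 < \<alpha>"
  defines "f \<equiv> \<lambda>t. (t - t0) powr (real n + \<alpha>) *\<^sub>R x"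
  shows "j \<le> n \<Longrightarrow> t \<in> {t0..t1} \<Longrightarrow> nth_deriv t0 t1 j f t =
      ((\<Prod>i<j. real n + \<alpha> - real i) * (t - t0) powr (real n + \<alpha> - real j)) *\<^sub>R x"
    and "f \<in> C_space n t0 t1"
proof -
  let ?c = "\<lambda>j. \<Prod>i<j. real n + \<alpha> - real i"
  let ?p = "\<lambda>j t. (?c j * (t - t0) powr (real n + \<alpha> - real j)) *\<^sub>R x"
  have der: "(?p j has_vector_derivative ?p (Suc j) t) (at t within {t0..t1})"
    if "j < n" "t \<in> {t0..t1}" for j t
  proof -
    define q where "q = real n + \<alpha> - real j"
    \<comment> \<open>As \<open>j < n\<close>, the exponent still exceeds 1, so the one-sided
      derivative at \<open>t0\<close> exists too.\<close>
    have q: "1 < q" using that \<alpha> unfolding q_def by linarith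
    have "((\<lambda>t. ?c j * (t - t0) powr q) has_real_derivative ?c j * (q * (t - t0) powr (q - 1))) (at t within {t0..t1})"
      by (intro DERIV_cmult has_real_derivative_powr_shift that q)
    from has_vector_derivative_scaleR[OF this has_vector_derivative_const[of x]]
    show ?thesis by (simp add: q_def algebra_simps)
  qed
  have eq: "j \<le> n \<Longrightarrow> t \<in> {t0..t1} \<Longrightarrow> nth_deriv t0 t1 j f t = ?p j t" for j t
  proof (induction j arbitrary: t)
    case 0
    then show ?case by (simp add: f_def)
  next
    case (Suc j)
    have "(nth_deriv t0 t1 j f has_vector_derivative ?p (Suc j) t) (at t within {t0..t1})"
      by (rule has_vector_derivative_transform[OF Suc.prems(2) Suc.IH der]) (use Suc.prems in auto)
    \<comment> \<open>Derivatives within a nondegenerate interval are unique, also at its end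
      points.\<close>
    then have "vector_derivative (nth_deriv t0 t1 j f) (at t within {t0..t1}) = ?p (Suc j) t"
      by (intro vector_derivative_within_cbox[of t0 t1, unfolded cbox_interval] t01 Suc.prems)
    then show ?case by (simp only: nth_deriv.simps)
  qed
  show "j \<le> n \<Longrightarrow> t \<in> {t0..t1} \<Longrightarrow> nth_deriv t0 t1 j f t = ?p j t" by (rule eq)
  show "f \<in> C_space n t0 t1"
    unfolding C_space_def mem_Collect_eq
  proof (intro conjI allI impI)
    fix j assume j: "j < n"
    have "(nth_deriv t0 t1 j f has_vector_derivative ?p (Suc j) t) (at t within {t0..t1})" if "t \<in> {t0..t1}" for t
      by (rule has_vector_derivative_transform[OF that eq der]) (use that j in auto)
    then show "nth_deriv t0 t1 j f differentiable_on {t0..t1}"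
      unfolding differentiable_on_def by (blast intro: differentiableI_vector)
  next
    have "continuous_on {t0..t1} (?p n)"
      using \<alpha> by (intro continuous_intros continuous_on_powr') auto
    then show "continuous_on {t0..t1} (nth_deriv t0 t1 n f)"
      by (rule continuous_on_eq) (simp only: eq order_refl)
  qed
qed

text \<open>Homogeneity replaces evaluating a Beta integral: under \<open>u = T * w\<close> the
  kernel scales by \<open>T powr (- \<alpha>)\<close>, the function by
  \<open>T powr \<alpha>\<close> and the length by \<open>T\<close>, so the integral at
  \<open>t0 + T\<close> is \<open>T\<close> times the one at \<open>t0 + 1\<close>. The latter is
  the vector \<open>z\<close>.\<close>

lemma abel_integral_powr_linear:
  fixes y :: "'a::banach"
  assumes \<alpha>: "0 < \<alpha>" "\<alpha> < 1"
  obtains z where "\<And>t. t0 \<le> t \<Longrightarrow> abel_integral \<alpha> t0 (\<lambda>s. (s - t0) powr \<alpha> *\<^sub>R y) t = (t - t0) *\<^sub>R z"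
proof -
  define g where "g s = max 0 (s - t0) powr \<alpha> *\<^sub>R y" for s
  have g: "continuous_on UNIV g"
    unfolding g_def using \<alpha> by (intro continuous_intros continuous_on_powr') auto
  have g0: "g s = 0" if "s \<le> t0" for s using that by (simp add: g_def)
  let ?A = "abel_integral \<alpha> t0 g" and ?R = "\<lambda>L. shifted_kernel_integral L \<alpha>"
  \<comment> \<open>The limit is taken along all positive shifts rather than a sequence, so that the
    shift may be rescaled below.\<close>
  have lim: "((\<lambda>\<epsilon>. ?R L \<epsilon> g t) \<longlongrightarrow> ?A t) (at_right 0)" if t: "t0 \<le> t" "t \<le> t0 + L" for t L
  proof -
    have B: "norm (g s) \<le> (t - t0) powr \<alpha> * norm y" if "s \<in> {t0..t}" for s
      using that \<alpha> by (auto simp: g_def intro!: mult_right_mono powr_mono2)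
    have "((\<lambda>\<epsilon>::real. \<epsilon> powr (1 - \<alpha>)) \<longlongrightarrow> 0 powr (1 - \<alpha>)) (at_right 0)"
      using \<alpha> by (intro tendsto_powr' tendsto_intros) (auto simp: eventually_at_right_field intro!: exI[of _ 1])
    then have z: "((\<lambda>\<epsilon>. (t - t0) powr \<alpha> * norm y * (\<epsilon> powr (1 - \<alpha>) / (1 - \<alpha>))) \<longlongrightarrow>
        (t - t0) powr \<alpha> * norm y * (0 / (1 - \<alpha>))) (at_right 0)"
      using \<alpha> by (intro tendsto_intros) auto
    have "((\<lambda>\<epsilon>. ?A t - ?R L \<epsilon> g t) \<longlongrightarrow> 0) (at_right 0)"
    proof (rule Lim_null_comparison)
      show "\<forall>\<^sub>F \<epsilon> in at_right 0. norm (?A t - ?R L \<epsilon> g t) \<le> (t - t0) powr \<alpha> * norm y * (\<epsilon> powr (1 - \<alpha>) / (1 - \<alpha>))"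
        using norm_abel_integral_diff_le[OF g g0 t \<alpha> B]
        by (auto simp: eventually_at_right_field intro!: exI[of _ 1])
    qed (use z in simp)
    then have "((\<lambda>\<epsilon>. ?A t - (?A t - ?R L \<epsilon> g t)) \<longlongrightarrow> ?A t - 0) (at_right 0)"
      by (intro tendsto_diff tendsto_const)
    then show ?thesis by simp
  qed
  \<comment> \<open>The shift scales with the variable: \<open>T * \<epsilon>\<close> on the
    interval of length \<open>T\<close> matches \<open>\<epsilon>\<close> on the unit
    interval.\<close>
  have scale: "?R T (T * \<epsilon>) g (t0 + T) = T *\<^sub>R ?R 1 \<epsilon> g (t0 + 1)" if T: "0 < T" and \<epsilon>: "0 < \<epsilon>" for T \<epsilon>
  proof -
    let ?h = "\<lambda>u. (u + T * \<epsilon>) powr (- \<alpha>) *\<^sub>R g (t0 + T - u)"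
    have pos: "u + T * \<epsilon> \<noteq> 0" if "0 \<le> u" for u
      using that mult_pos_pos[OF T \<epsilon>] by linarith
    have "(?h has_integral ?R T (T * \<epsilon>) g (t0 + T)) {0..T}"
      unfolding shifted_kernel_integral_def using pos
      by (intro integrable_integral integrable_continuous_real continuous_intros continuous_on_compose2[OF g]) auto
    from has_integral_stretch_real[OF this, of T] T
    have "((\<lambda>w. ?h (T * w)) has_integral (1 / T) *\<^sub>R ?R T (T * \<epsilon>) g (t0 + T)) ((\<lambda>x. x / T) ` {0..T})"
      by simp
    moreover have "(\<lambda>x. x / T) ` {0..T} = {0..1}" using T by simp
    ultimately have "((\<lambda>w. ?h (T * w)) has_integral (1 / T) *\<^sub>R ?R T (T * \<epsilon>) g (t0 + T)) {0..1}"
      by simp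
    then have "((\<lambda>w. (w + \<epsilon>) powr (- \<alpha>) *\<^sub>R g (t0 + 1 - w)) has_integral (1 / T) *\<^sub>R ?R T (T * \<epsilon>) g (t0 + T)) {0..1}"
    proof (rule has_integral_eq[rotated])
      fix w :: real assume w: "w \<in> {0..1}"
      have "T * w + T * \<epsilon> = T * (w + \<epsilon>)" "t0 + T - T * w - t0 = T * (1 - w)" by algebra+
      moreover have "(T * (w + \<epsilon>)) powr (- \<alpha>) * (T * (1 - w)) powr \<alpha> = (w + \<epsilon>) powr (- \<alpha>) * (1 - w) powr \<alpha>"
        using w T \<epsilon> by (simp add: powr_mult powr_minus)
      moreover have "max 0 (T * (1 - w)) = T * (1 - w)" "max 0 (1 - w) = 1 - w" using w T by auto
      ultimately show "?h (T * w) = (w + \<epsilon>) powr (- \<alpha>) *\<^sub>R g (t0 + 1 - w)"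
        by (simp add: g_def)
    qed
    then have "?R 1 \<epsilon> g (t0 + 1) = (1 / T) *\<^sub>R ?R T (T * \<epsilon>) g (t0 + T)"
      unfolding shifted_kernel_integral_def[of 1] by (rule integral_unique)
    then show ?thesis using T by simp
  qed
  have lin: "?A t = (t - t0) *\<^sub>R ?A (t0 + 1)" if t: "t0 \<le> t" for t
  proof (cases "t = t0")
    case True
    \<comment> \<open>With \<open>L = 0\<close> the regularised integral is over a single point, and
      \<open>B = 0\<close> is admissible since \<open>g t0 = 0\<close>.\<close>
    have "norm (?A t0 - ?R 0 1 g t0) \<le> 0 * (1 powr (1 - \<alpha>) / (1 - \<alpha>))"
      by (rule norm_abel_integral_diff_le[OF g g0 _ _ \<alpha>]) (auto simp: g_def)
    then show ?thesis using True by (simp add: shifted_kernel_integral_def)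
  next
    case False
    define T where "T = t - t0"
    have T: "0 < T" using False t by (simp add: T_def)
    have "filterlim (\<lambda>\<epsilon>. T * \<epsilon>) (at_right 0) (at_right 0)"
      by (rule filterlim_times_pos[OF filterlim_ident T]) simp
    then have 1: "((\<lambda>\<epsilon>. ?R T (T * \<epsilon>) g (t0 + T)) \<longlongrightarrow> ?A (t0 + T)) (at_right 0)"
      using T by (intro filterlim_compose[OF lim]) auto
    have "((\<lambda>\<epsilon>. T *\<^sub>R ?R 1 \<epsilon> g (t0 + 1)) \<longlongrightarrow> T *\<^sub>R ?A (t0 + 1)) (at_right 0)"
      by (intro tendsto_intros lim) auto
    then have "((\<lambda>\<epsilon>. ?R T (T * \<epsilon>) g (t0 + T)) \<longlongrightarrow> T *\<^sub>R ?A (t0 + 1)) (at_right 0)"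
      by (rule Lim_transform_eventually)
        (use scale[OF T] in \<open>auto simp: eventually_at_right_field intro!: exI[of _ 1]\<close>)
    from tendsto_unique[OF _ 1 this] show ?thesis by (simp add: T_def)
  qed
  have eq: "abel_integral \<alpha> t0 (\<lambda>s. (s - t0) powr \<alpha> *\<^sub>R y) t = ?A t" for t
    by (rule abel_integral_cong) (simp add: g_def)
  show thesis by (rule that[OF trans[OF eq lin]])
qed

section \<open>The continuous inclusion\<close>

text \<open>The constant \<open>M\<close> makes the quotients bounded, so the supremum is itself an
  admissible Hoelder constant. This replaces the unspecified constant of \<open>H_space\<close> by
  the seminorm in \<open>H_norm\<close>, as the norm estimate requires.\<close>

lemma hoelder_seminorm:
  fixes g :: "real \<Rightarrow> 'a::banach"
  assumes t01: "t0 < t1"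
    and M: "\<And>t s. t \<in> {t0..t1} \<Longrightarrow> s \<in> {t0..t1} \<Longrightarrow> norm (g t - g s) \<le> M * \<bar>t - s\<bar> powr \<beta>"
  defines "H \<equiv> SUP (t, s)\<in>{(t, s). t \<in> {t0..t1} \<and> s \<in> {t0..t1} \<and> t \<noteq> s}. norm (g t - g s) / \<bar>t - s\<bar> powr \<beta>"
  shows "0 \<le> H"
    and "t \<in> {t0..t1} \<Longrightarrow> s \<in> {t0..t1} \<Longrightarrow> norm (g t - g s) \<le> H * \<bar>t - s\<bar> powr \<beta>"
proof -
  let ?S = "{(t, s). t \<in> {t0..t1} \<and> s \<in> {t0..t1} \<and> t \<noteq> s}"
  let ?q = "\<lambda>(t, s). norm (g t - g s) / \<bar>t - s\<bar> powr \<beta>"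
  have "?q p \<le> M" if "p \<in> ?S" for p
    using that M by (auto simp: divide_le_eq)
  then have bdd: "bdd_above (?q ` ?S)" by (rule bdd_aboveI2)
  have le: "norm (g t - g s) / \<bar>t - s\<bar> powr \<beta> \<le> H" if "t \<in> {t0..t1}" "s \<in> {t0..t1}" "t \<noteq> s" for t s
    unfolding H_def using cSUP_upper[OF _ bdd, of "(t, s)"] that by simp
  have "0 \<le> norm (g t1 - g t0) / \<bar>t1 - t0\<bar> powr \<beta>" by simp
  also have "\<dots> \<le> H" using t01 by (intro le) auto
  finally show "0 \<le> H" .
  show "norm (g t - g s) \<le> H * \<bar>t - s\<bar> powr \<beta>" if "t \<in> {t0..t1}" "s \<in> {t0..t1}"
    using le[OF that] by (cases "t = s") (auto simp: divide_le_eq)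
qed

lemma H0_space_RL_bound:
  fixes f :: "real \<Rightarrow> 'a::banach"
  assumes t01: "t0 < t1" and \<alpha>: "0 < \<alpha>" "\<alpha> < \<beta>" "\<beta> \<le> 1" and f: "f \<in> H0_space n \<beta> t0 t1"
  shows "f \<in> RL_space (real n + \<alpha>) t0 t1"
    and "RL_norm (real n + \<alpha>) t0 t1 f \<le>
      (1 + \<bar>1 / Gamma (1 - \<alpha>)\<bar> * ((t1 - t0) powr (\<beta> - \<alpha>) * (1 + \<alpha> / (\<beta> - \<alpha>)))) * H_norm n \<beta> t0 t1 f"
proof -
  let ?c = "1 / Gamma (1 - \<alpha>)" and ?K = "(t1 - t0) powr (\<beta> - \<alpha>) * (1 + \<alpha> / (\<beta> - \<alpha>))"
  have \<alpha>1: "\<alpha> < 1" using \<alpha> by simp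
  define h where "h = nth_deriv t0 t1 n f"
  define H where "H = (SUP (t, s)\<in>{(t, s). t \<in> {t0..t1} \<and> s \<in> {t0..t1} \<and> t \<noteq> s}. norm (h t - h s) / \<bar>t - s\<bar> powr \<beta>)"
  have fC: "f \<in> C_space n t0 t1" and f0: "\<And>j. j \<le> n \<Longrightarrow> nth_deriv t0 t1 j f t0 = 0"
    using f by (auto simp: H0_space_def H_space_def)
  obtain M where "\<forall>t\<in>{t0..t1}. \<forall>s\<in>{t0..t1}. norm (h t - h s) \<le> M * \<bar>t - s\<bar> powr \<beta>"
    using f unfolding h_def H0_space_def H_space_def by blast
  then have M: "\<And>t s. t \<in> {t0..t1} \<Longrightarrow> s \<in> {t0..t1} \<Longrightarrow> norm (h t - h s) \<le> M * \<bar>t - s\<bar> powr \<beta>"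
    by blast
  have H0: "0 \<le> H" unfolding H_def by (rule hoelder_seminorm(1)[OF t01 M])
  have H: "norm (h t - h s) \<le> H * \<bar>t - s\<bar> powr \<beta>" if "t \<in> {t0..t1}" "s \<in> {t0..t1}" for t s
    unfolding H_def by (rule hoelder_seminorm(2)[OF t01 M that])
  define g where "g t = h (max t0 (min t1 t))" for t
  have gc: "continuous_on UNIV g"
    unfolding g_def h_def using t01
    by (intro continuous_on_constant_extension continuous_on_nth_deriv[OF fC]) auto
  have g0: "g s = 0" if "s \<le> t0" for s
    using that t01 f0[of n] by (simp add: g_def h_def min_def)
  \<comment> \<open>Clamping does not increase distances, so the extension keeps the constant
    \<open>H\<close>.\<close>
  have gH: "norm (g x - g y) \<le> H * \<bar>x - y\<bar> powr \<beta>" for x y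
  proof -
    have "norm (g x - g y) \<le> H * \<bar>max t0 (min t1 x) - max t0 (min t1 y)\<bar> powr \<beta>"
      unfolding g_def using t01 by (intro H) auto
    also have "\<dots> \<le> H * \<bar>x - y\<bar> powr \<beta>"
      using \<alpha> H0 by (intro mult_left_mono powr_mono2) auto
    finally show ?thesis .
  qed
  obtain v where v: "continuous_on {t0..t1} v"
    "\<And>t. t \<in> {t0..t1} \<Longrightarrow> (abel_integral \<alpha> t0 g has_vector_derivative v t) (at t within {t0..t1})"
    "\<And>t. t \<in> {t0..t1} \<Longrightarrow> norm (v t) \<le> H * ?K"
    using abel_integral_hoelder[OF gc g0 gH \<alpha>(1,2) \<alpha>1 t01] by blast
  have "(abel_integral \<alpha> t0 (nth_deriv t0 t1 n f) has_vector_derivative v t) (at t within {t0..t1})"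
    if t: "t \<in> {t0..t1}" for t
  proof (rule has_vector_derivative_transform[OF t _ v(2)[OF t]])
    show "abel_integral \<alpha> t0 (nth_deriv t0 t1 n f) s = abel_integral \<alpha> t0 g s" if "s \<in> {t0..t1}" for s
      using that by (intro abel_integral_cong) (simp add: g_def h_def)
  qed
  then have RL: "has_RL_deriv (real n + \<alpha>) t0 t1 f (\<lambda>t. ?c *\<^sub>R v t)"
    by (intro has_RL_derivI[OF t01 \<alpha>(1) \<alpha>1 fC f0 v(1)])
  have cv: "continuous_on {t0..t1} (\<lambda>t. ?c *\<^sub>R v t)" by (intro continuous_intros v(1))
  show "f \<in> RL_space (real n + \<alpha>) t0 t1" by (rule RL_spaceI[OF \<alpha>(1) \<alpha>1 fC cv RL])
  have "norm (RL_deriv (real n + \<alpha>) t0 t1 f t) \<le> \<bar>?c\<bar> * (H * ?K)" if "t \<in> {t0..t1}" for t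
    unfolding RL_deriv_eq[OF t01 cv RL that] norm_scaleR
    using v(3)[OF that] by (intro mult_left_mono) auto
  then have D: "C_norm 0 t0 t1 (RL_deriv (real n + \<alpha>) t0 t1 f) \<le> \<bar>?c\<bar> * (H * ?K)"
    unfolding C_norm_def using t01 by (simp del: abs_divide) (rule cSUP_least, auto)
  have C: "0 \<le> \<bar>?c\<bar> * ?K * C_norm n t0 t1 f"
    using \<alpha> C_norm_nonneg[OF fC] t01 by simp
  have HN: "H_norm n \<beta> t0 t1 f = C_norm n t0 t1 f + H"
    by (simp add: H_norm_def H_def h_def)
  have RN: "RL_norm (real n + \<alpha>) t0 t1 f = C_norm n t0 t1 f + C_norm 0 t0 t1 (RL_deriv (real n + \<alpha>) t0 t1 f)"
    by (simp add: RL_norm_def ceiling_nat_plus[OF \<alpha>(1) \<alpha>1] nat_add_distrib)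
  \<comment> \<open>Here \<open>R = C + D\<close> is at most \<open>C + a * k * H\<close>, and
    expanding \<open>(1 + a * k) * (C + H)\<close> adds only the nonnegative terms \<open>H\<close>
    and \<open>a * k * C\<close>.\<close>
  have "R \<le> (1 + a * k) * N" if "D \<le> a * (H * k)" "0 \<le> a * k * C" "N = C + H" "R = C + D"
    for R a k N C D :: real
    using that H0 by (simp add: algebra_simps)
  from this[OF D C HN RN]
  show "RL_norm (real n + \<alpha>) t0 t1 f \<le> (1 + \<bar>?c\<bar> * ?K) * H_norm n \<beta> t0 t1 f" .
qed

section \<open>Strictness of the inclusion\<close>

text \<open>The \<open>n\<close>-th derivative is \<open>c\<close> times
  \<open>(t - t0) powr \<alpha>\<close> in direction \<open>x\<close>, whose Abel integral is linear
  in \<open>t - t0\<close>; the fractional derivative is therefore constant.\<close>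

lemma powr_in_RL_space:
  fixes x :: "'a::banach"
  assumes t01: "t0 < t1" and \<alpha>: "0 < \<alpha>" "\<alpha> < 1"
  shows "(\<lambda>t. (t - t0) powr (real n + \<alpha>) *\<^sub>R x) \<in> RL_space (real n + \<alpha>) t0 t1"
proof -
  let ?f = "\<lambda>t. (t - t0) powr (real n + \<alpha>) *\<^sub>R x"
  note nd = nth_deriv_powr[OF t01 \<alpha>(1), where x=x and n=n]
  define c where "c = (\<Prod>i<n. real n + \<alpha> - real i)"
  obtain z where z: "\<And>t. t0 \<le> t \<Longrightarrow> abel_integral \<alpha> t0 (\<lambda>s. (s - t0) powr \<alpha> *\<^sub>R (c *\<^sub>R x)) t = (t - t0) *\<^sub>R z"
    using abel_integral_powr_linear[of \<alpha> t0 "c *\<^sub>R x", OF \<alpha>] by blast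
  have f0: "nth_deriv t0 t1 j ?f t0 = 0" if "j \<le> n" for j
    using nd(1)[OF that, of t0] t01 by simp
  have "has_RL_deriv (real n + \<alpha>) t0 t1 ?f (\<lambda>t. (1 / Gamma (1 - \<alpha>)) *\<^sub>R z)"
  proof (rule has_RL_derivI[OF t01 \<alpha> nd(2) f0])
    fix t assume t: "t \<in> {t0..t1}"
    have "((\<lambda>t. (t - t0) *\<^sub>R z) has_vector_derivative z) (at t within {t0..t1})"
      by (auto intro!: derivative_eq_intros)
    then show "(abel_integral \<alpha> t0 (nth_deriv t0 t1 n ?f) has_vector_derivative z) (at t within {t0..t1})"
    proof (rule has_vector_derivative_transform[OF t, rotated])
      fix s assume s: "s \<in> {t0..t1}"
      have "abel_integral \<alpha> t0 (nth_deriv t0 t1 n ?f) s = abel_integral \<alpha> t0 (\<lambda>s. (s - t0) powr \<alpha> *\<^sub>R (c *\<^sub>R x)) s"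
      proof (rule abel_integral_cong)
        fix r assume "r \<in> {t0..s}"
        then have "r \<in> {t0..t1}" using s by auto
        from nd(1)[OF order_refl this]
        show "nth_deriv t0 t1 n ?f r = (r - t0) powr \<alpha> *\<^sub>R (c *\<^sub>R x)"
          by (simp add: c_def mult.commute)
      qed
      then show "abel_integral \<alpha> t0 (nth_deriv t0 t1 n ?f) s = (s - t0) *\<^sub>R z"
        using z s by simp
    qed
  qed (use continuous_on_const in auto)
  then show ?thesis by (intro RL_spaceI[OF \<alpha> nd(2) continuous_on_const])
qed

text \<open>Comparing the \<open>n\<close>-th derivative at \<open>t0 + r\<close> and
  \<open>t0\<close> gives \<open>c * r powr \<alpha> * norm x \<le> M * r powr \<beta>\<close>.
  Dividing by \<open>r powr \<alpha>\<close> and letting \<open>r\<close> tend to 0 forces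
  \<open>c * norm x \<le> 0\<close>.\<close>

lemma powr_notin_H_space:
  fixes x :: "'a::banach"
  assumes t01: "t0 < t1" and \<alpha>: "0 < \<alpha>" "\<alpha> < \<beta>" and x: "x \<noteq> 0"
  shows "(\<lambda>t. (t - t0) powr (real n + \<alpha>) *\<^sub>R x) \<notin> H_space n \<beta> t0 t1"
proof
  let ?f = "\<lambda>t. (t - t0) powr (real n + \<alpha>) *\<^sub>R x"
  assume "?f \<in> H_space n \<beta> t0 t1"
  then obtain M where M: "\<And>t s. t \<in> {t0..t1} \<Longrightarrow> s \<in> {t0..t1} \<Longrightarrow>
      norm (nth_deriv t0 t1 n ?f t - nth_deriv t0 t1 n ?f s) \<le> M * \<bar>t - s\<bar> powr \<beta>"
    unfolding H_space_def by blast
  define c where "c = (\<Prod>i<n. real n + \<alpha> - real i)"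
  \<comment> \<open>Every factor has \<open>i < n\<close>, so it exceeds
    \<open>\<alpha>\<close>.\<close>
  have c: "c > 0" unfolding c_def using \<alpha> by (intro prod_pos) auto
  note nd = nth_deriv_powr(1)[OF t01 \<alpha>(1), where x=x and n=n and j=n, OF order_refl, folded c_def]
  have le: "c * norm x \<le> M * r powr (\<beta> - \<alpha>)" if r: "0 < r" "r < t1 - t0" for r
  proof -
    have "norm (nth_deriv t0 t1 n ?f (t0 + r) - nth_deriv t0 t1 n ?f t0) \<le> M * \<bar>t0 + r - t0\<bar> powr \<beta>"
      using r by (intro M) auto
    then have "c * r powr \<alpha> * norm x \<le> M * r powr \<beta>"
      using nd[of "t0 + r"] nd[of t0] r c by (simp add: abs_mult)
    then have "(c * norm x) * r powr \<alpha> \<le> (M * r powr (\<beta> - \<alpha>)) * r powr \<alpha>"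
      using r by (simp add: powr_diff mult_ac)
    then show ?thesis using r by (simp add: mult_le_cancel_right)
  qed
  have "((\<lambda>r::real. r powr (\<beta> - \<alpha>)) \<longlongrightarrow> 0 powr (\<beta> - \<alpha>)) (at_right 0)"
    using \<alpha> by (intro tendsto_powr' tendsto_intros) (auto simp: eventually_at_right_field intro!: exI[of _ 1])
  then have "((\<lambda>r. M * r powr (\<beta> - \<alpha>)) \<longlongrightarrow> M * 0) (at_right 0)"
    using \<alpha> by (intro tendsto_intros) simp
  then have "c * norm x \<le> M * 0"
    by (rule tendsto_lowerbound)
      (use le t01 in \<open>auto simp: eventually_at_right_field intro!: exI[of _ "t1 - t0"]\<close>)
  then show False using c x by (simp add: mult_le_0_iff)
qed

theorem corollary19:
  fixes t0 t1 \<alpha> \<beta> :: real and n :: nat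
  assumes "(UNIV :: 'a::banach set) \<noteq> {0}"
    and "t0 < t1"
    and "0 < \<alpha>" and "\<alpha> < \<beta>" and "\<beta> \<le> 1"
  shows "(H0_space n \<beta> t0 t1 :: (real \<Rightarrow> 'a) set) \<subset> RL_space (real n + \<alpha>) t0 t1 \<and>
         (\<exists>M>0. \<forall>f \<in> (H0_space n \<beta> t0 t1 :: (real \<Rightarrow> 'a) set).
           RL_norm (real n + \<alpha>) t0 t1 f \<le> M * H_norm n \<beta> t0 t1 f)"
proof
  obtain x :: 'a where x: "x \<noteq> 0" using assms(1) by blast
  let ?f = "\<lambda>t. (t - t0) powr (real n + \<alpha>) *\<^sub>R x"
  have "?f \<in> RL_space (real n + \<alpha>) t0 t1"
    using assms by (intro powr_in_RL_space) auto
  moreover have "?f \<notin> H0_space n \<beta> t0 t1"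
    using powr_notin_H_space[OF assms(2-4) x, of n] by (simp add: H0_space_def)
  moreover have "(H0_space n \<beta> t0 t1 :: (real \<Rightarrow> 'a) set) \<subseteq> RL_space (real n + \<alpha>) t0 t1"
    using H0_space_RL_bound(1)[OF assms(2-5)] by blast
  ultimately show "(H0_space n \<beta> t0 t1 :: (real \<Rightarrow> 'a) set) \<subset> RL_space (real n + \<alpha>) t0 t1"
    by blast
  let ?M = "1 + \<bar>1 / Gamma (1 - \<alpha>)\<bar> * ((t1 - t0) powr (\<beta> - \<alpha>) * (1 + \<alpha> / (\<beta> - \<alpha>)))"
  have "0 < ?M" using assms by (intro add_pos_nonneg mult_nonneg_nonneg) auto
  moreover have "\<forall>f \<in> (H0_space n \<beta> t0 t1 :: (real \<Rightarrow> 'a) set).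
      RL_norm (real n + \<alpha>) t0 t1 f \<le> ?M * H_norm n \<beta> t0 t1 f"
    using H0_space_RL_bound(2)[OF assms(2-5)] by blast
  ultimately show "\<exists>M>0. \<forall>f \<in> (H0_space n \<beta> t0 t1 :: (real \<Rightarrow> 'a) set).
      RL_norm (real n + \<alpha>) t0 t1 f \<le> M * H_norm n \<beta> t0 t1 f"
    by blast
qed

end
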